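(* Let $K$ be a field of characteristic $0$, $d\ge2$, and let $\alpha=(\alpha_1,\alpha_2)\in K^2$ with $\alpha_2=0$, $\alpha_1\ne0$. In $G_d(\mathfrak U_\alpha)$ the consequences of degree $n+1$ of polynomials of degree $n$ are equivalent to the following: (i) An identity of degree $1$ or $2$ implies, respectively, all polynomials of degree $2$ and $3$ in $G_d(\mathfrak U_\alpha)$. (ii) Each of the identities $w_{(3)}^{(1)}$ and $\beta_1w_{(2,1)}^{(1)}+\beta_2w_{(2,1)}^{(0)}$, $\beta_2\ne0$, implies $w_{(4)}^{(1)}$ and $w_{(3,1)}^{(0)}$, i.e. all polynomials of degree $4$. (iii) For $n\ge4$ each of the identities $w_{(n)}^{(1)}$ and $w_{(n-1,1)}^{(0)}$ implies $w_{(n+1)}^{(1)}$ and $w_{(n,1)}^{(0)}$, i.e. all polynomials of degree $n+1$. (iv) The polynomial $w_{(2,1)}^{(1)}$ has no (nonzero) consequences of degree $4$.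
   Context: A bicommutative algebra is a nonassociative $K$-algebra satisfying $(x_1x_2)x_3=(x_1x_3)x_2$ and $x_1(x_2x_3)=x_2(x_1x_3)$; $\mathfrak B$ is the variety of all of them. The free bicommutative algebra $F_d(\mathfrak B)$ on $x_1,\dots,x_d$ is identified (via $x_i\mapsto x_i$) with the algebra $G_d$ having as basis $x_1,\dots,x_d$ together with all monomials $Y^aZ^b=y_1^{a_1}\cdots y_d^{a_d}z_1^{b_1}\cdots z_d^{b_d}$ in the polynomial algebra $K[y_1,\dots,y_d,z_1,\dots,z_d]$ with $|a|\ge1$ and $|b|\ge1$, and multiplication $x_ix_j=y_iz_j$, $x_i(Y^aZ^b)=y_iY^aZ^b$, $(Y^aZ^b)x_i=Y^aZ^bz_i$, $(Y^aZ^b)(Y^cZ^e)=Y^{a+c}Z^{b+e}$. The group $GL_d(K)$ acts on $G_d$ by automorphisms extending its linear action on the span of $x_1,\dots,x_d$. Put $w_{(1)}=x_1$, $w_{(n)}^{(j)}=y_1^jz_1^{n-j}$ ($1\le j\le n-1$), and $w_{(\lambda_1,\lambda_2)}^{(j)}=y_1^j(y_1z_2-y_2z_1)^{\lambda_2}z_1^{\lambda_1-\lambda_2-j}$ for $\lambda_2>0$, $0\le j\le\lambda_1-\lambda_2$; $(1^2)=(1,1)$. $\mathfrak U_\alpha$, $\alpha=(\alpha_1,\alpha_2)\ne(0,0)$, is the variety of bicommutative algebras defined by the identity $\alpha_1x(xx)+\alpha_2(xx)x=0$, and $G_d(\mathfrak U_\alpha)\cong F_d(\mathfrak U_\alpha)$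 is the factor algebra of $G_d$ modulo the T-ideal (ideal closed under all endomorphisms) generated by $\alpha_1y_1^2z_1+\alpha_2y_1z_1^2$; elements of $G_d$ denote also their images. For a homogeneous $f$ of degree $n$ in $G_d(\mathfrak U_\alpha)$, its consequences of degree $n+1$ are the elements of the degree $n+1$ homogeneous component of the T-ideal of $G_d(\mathfrak U_\alpha)$ generated by $f$ (one says $f$ implies these elements). They are "equivalent to" a list of polynomials if this component equals the $GL_d(K)$-submodule generated by the list. An "identity of degree $n$" is a nonzero homogeneous element of degree $n$ of $G_d(\mathfrak U_\alpha)$. *)

theory Defs
  imports "HOL-Library.Poly_Mapping" "HOL-Library.Product_Plus" "HOL-Library.FuncSet"
begin

section \<open>Nonassociative algebras over a field\<close>

record ('k, 'a) nalg =
  carrier :: "'a set"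
  zero :: 'a
  add :: "'a \<Rightarrow> 'a \<Rightarrow> 'a"
  scale :: "'k \<Rightarrow> 'a \<Rightarrow> 'a"
  mult :: "'a \<Rightarrow> 'a \<Rightarrow> 'a"

definition subspace_of :: "('k, 'a) nalg \<Rightarrow> 'a set \<Rightarrow> bool" where
  "subspace_of A S \<longleftrightarrow> S \<subseteq> carrier A \<and> zero A \<in> S \<and>
     (\<forall>p\<in>S. \<forall>q\<in>S. add A p q \<in> S) \<and> (\<forall>c. \<forall>p\<in>S. scale A c p \<in> S)"

definition ideal_of :: "('k, 'a) nalg \<Rightarrow> 'a set \<Rightarrow> bool" where
  "ideal_of A J \<longleftrightarrow> subspace_of A J \<and>
     (\<forall>p\<in>carrier A. \<forall>q\<in>J. mult A p q \<in> J \<and> mult A q p \<in> J)"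

definition endomorphism :: "('k, 'a) nalg \<Rightarrow> ('a \<Rightarrow> 'a) \<Rightarrow> bool" where
  "endomorphism A \<phi> \<longleftrightarrow> \<phi> \<in> carrier A \<rightarrow> carrier A \<and>
     (\<forall>p\<in>carrier A. \<forall>q\<in>carrier A. \<phi> (add A p q) = add A (\<phi> p) (\<phi> q)) \<and>
     (\<forall>c. \<forall>p\<in>carrier A. \<phi> (scale A c p) = scale A c (\<phi> p)) \<and>
     (\<forall>p\<in>carrier A. \<forall>q\<in>carrier A. \<phi> (mult A p q) = mult A (\<phi> p) (\<phi> q))"

definition automorphism :: "('k, 'a) nalg \<Rightarrow> ('a \<Rightarrow> 'a) \<Rightarrow> bool" where
  "automorphism A \<phi> \<longleftrightarrow> endomorphism A \<phi> \<and> bij_betw \<phi> (carrier A) (carrier A)"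

definition T_ideal :: "('k, 'a) nalg \<Rightarrow> 'a set \<Rightarrow> bool" where
  "T_ideal A J \<longleftrightarrow> ideal_of A J \<and> (\<forall>\<phi>. endomorphism A \<phi> \<longrightarrow> \<phi> ` J \<subseteq> J)"

definition T_ideal_gen :: "('k, 'a) nalg \<Rightarrow> 'a set \<Rightarrow> 'a set" where
  "T_ideal_gen A S = \<Inter>{J. T_ideal A J \<and> S \<subseteq> J}"

definition coset :: "('k, 'a) nalg \<Rightarrow> 'a set \<Rightarrow> 'a \<Rightarrow> 'a set" where
  "coset A J p = add A p ` J"

definition factor_alg :: "('k, 'a) nalg \<Rightarrow> 'a set \<Rightarrow> ('k, 'a set) nalg" where
  "factor_alg A J = \<lparr>
     carrier = coset A J ` carrier A,
     zero = J,
     add = (\<lambda>P Q. \<Union>p\<in>P. \<Union>q\<in>Q. coset A J (add A p q)),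
     scale = (\<lambda>c P. \<Union>p\<in>P. coset A J (scale A c p)),
     mult = (\<lambda>P Q. \<Union>p\<in>P. \<Union>q\<in>Q. coset A J (mult A p q))\<rparr>"

section \<open>The algebra \<open>G\<^sub>d\<close>\<close>

text \<open>
  A polynomial in the variables \<open>y\<^sub>i, z\<^sub>i\<close> is a finitely supported function on pairs \<open>(a, b)\<close> of
  exponent vectors, the pair \<open>(a, b)\<close> standing for \<open>Y\<^sup>a Z\<^sup>b\<close>; its product is the convolution product
  of \<^theory>\<open>HOL-Library.Poly_Mapping\<close>. An element of \<open>G\<^sub>d\<close> is a pair \<open>(u, f)\<close>, where \<open>u\<close> holds the
  coefficients of \<open>x\<^sub>1, \<dots>, x\<^sub>d\<close> and \<open>f\<close> is the polynomial part. Variables are numbered from 1.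
\<close>

type_synonym 'k yzpoly = "((nat \<Rightarrow>\<^sub>0 nat) \<times> (nat \<Rightarrow>\<^sub>0 nat)) \<Rightarrow>\<^sub>0 'k"
type_synonym 'k gelem = "(nat \<Rightarrow>\<^sub>0 'k) \<times> 'k yzpoly"

definition mdeg :: "(nat \<Rightarrow>\<^sub>0 nat) \<Rightarrow> nat" where
  "mdeg a = (\<Sum>i\<in>Poly_Mapping.keys a. Poly_Mapping.lookup a i)"

definition YZ :: "(nat \<Rightarrow>\<^sub>0 nat) \<Rightarrow> (nat \<Rightarrow>\<^sub>0 nat) \<Rightarrow> 'k::field yzpoly" where
  "YZ a b = Poly_Mapping.single (a, b) 1"

definition yv :: "nat \<Rightarrow> 'k::field yzpoly" where
  "yv i = YZ (Poly_Mapping.single i 1) 0"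

definition zv :: "nat \<Rightarrow> 'k::field yzpoly" where
  "zv i = YZ 0 (Poly_Mapping.single i 1)"

definition gx :: "nat \<Rightarrow> 'k::field gelem" where
  "gx i = (Poly_Mapping.single i 1, 0)"

definition gpoly :: "'k::field yzpoly \<Rightarrow> 'k gelem" where
  "gpoly f = (0, f)"

definition gscale :: "'k::field \<Rightarrow> 'k gelem \<Rightarrow> 'k gelem" where
  "gscale c p = (Poly_Mapping.map ((*) c) (fst p), Poly_Mapping.map ((*) c) (snd p))"

text \<open>
  The linear maps \<open>x\<^sub>i \<mapsto> y\<^sub>i, Y\<^sup>a Z\<^sup>b \<mapsto> Y\<^sup>a Z\<^sup>b\<close> and \<open>x\<^sub>i \<mapsto> z\<^sub>i, Y\<^sup>a Z\<^sup>b \<mapsto> Y\<^sup>a Z\<^sup>b\<close>: left factors of a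
  product enter through the first one, right factors through the second one.
\<close>

definition to_y :: "'k::field gelem \<Rightarrow> 'k yzpoly" where
  "to_y p = (\<Sum>i\<in>Poly_Mapping.keys (fst p).
     Poly_Mapping.single (Poly_Mapping.single i 1, 0) (Poly_Mapping.lookup (fst p) i)) + snd p"

definition to_z :: "'k::field gelem \<Rightarrow> 'k yzpoly" where
  "to_z p = (\<Sum>i\<in>Poly_Mapping.keys (fst p).
     Poly_Mapping.single (0, Poly_Mapping.single i 1) (Poly_Mapping.lookup (fst p) i)) + snd p"

definition gmult :: "'k::field gelem \<Rightarrow> 'k gelem \<Rightarrow> 'k gelem" where
  "gmult p q = gpoly (to_y p * to_z q)"

lemma gmult_basis:
  "gmult (gx i) (gx j) = gpoly (yv i * zv j :: 'k::field yzpoly)"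
  "gmult (gx i) (gpoly (YZ a b)) = gpoly (yv i * YZ a b :: 'k yzpoly)"
  "gmult (gpoly (YZ a b)) (gx i) = gpoly (YZ a b * zv i :: 'k yzpoly)"
  "gmult (gpoly (YZ a b)) (gpoly (YZ c e)) = gpoly (YZ (a + c) (b + e) :: 'k yzpoly)"
  by (simp_all add: gmult_def gx_def gpoly_def to_y_def to_z_def yv_def zv_def YZ_def mult_single)

definition galg :: "nat \<Rightarrow> ('k::field, 'k gelem) nalg" where
  "galg d = \<lparr>
     carrier = {p. Poly_Mapping.keys (fst p) \<subseteq> {1..d} \<and>
       (\<forall>(a, b)\<in>Poly_Mapping.keys (snd p).
          Poly_Mapping.keys a \<subseteq> {1..d} \<and> Poly_Mapping.keys b \<subseteq> {1..d} \<and> 1 \<le> mdeg a \<and> 1 \<le> mdeg b)},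
     zero = 0,
     add = (+),
     scale = gscale,
     mult = gmult\<rparr>"

definition gcomp :: "nat \<Rightarrow> nat \<Rightarrow> 'k::field gelem set" where
  "gcomp d n = {p \<in> carrier (galg d). (n \<noteq> 1 \<longrightarrow> fst p = 0) \<and>
     (\<forall>(a, b)\<in>Poly_Mapping.keys (snd p). mdeg a + mdeg b = n)}"

definition w_one :: "nat \<Rightarrow> nat \<Rightarrow> 'k::field gelem" where
  "w_one n j = gpoly (yv 1 ^ j * zv 1 ^ (n - j))"

definition w_two :: "nat \<Rightarrow> nat \<Rightarrow> nat \<Rightarrow> 'k::field gelem" where
  "w_two l1 l2 j = gpoly (yv 1 ^ j * (yv 1 * zv 2 - yv 2 * zv 1) ^ l2 * zv 1 ^ (l1 - l2 - j))"

section \<open>The relatively free algebra \<open>G\<^sub>d(\<UU>\<^sub>\<alpha>)\<close>\<close>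

definition U_ideal :: "nat \<Rightarrow> 'k \<times> 'k \<Rightarrow> 'k::field gelem set" where
  "U_ideal d \<alpha> = T_ideal_gen (galg d)
     {gscale (fst \<alpha>) (gpoly (yv 1 ^ 2 * zv 1)) + gscale (snd \<alpha>) (gpoly (yv 1 * zv 1 ^ 2))}"

definition U_alg :: "nat \<Rightarrow> 'k \<times> 'k \<Rightarrow> ('k::field, 'k gelem set) nalg" where
  "U_alg d \<alpha> = factor_alg (galg d) (U_ideal d \<alpha>)"

definition U_img :: "nat \<Rightarrow> 'k \<times> 'k \<Rightarrow> 'k::field gelem \<Rightarrow> 'k gelem set" where
  "U_img d \<alpha> p = coset (galg d) (U_ideal d \<alpha>) p"

definition U_comp :: "nat \<Rightarrow> 'k \<times> 'k \<Rightarrow> nat \<Rightarrow> 'k::field gelem set set" where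
  "U_comp d \<alpha> n = U_img d \<alpha> ` gcomp d n"

definition U_identity :: "nat \<Rightarrow> 'k \<times> 'k \<Rightarrow> nat \<Rightarrow> 'k::field gelem set \<Rightarrow> bool" where
  "U_identity d \<alpha> n F \<longleftrightarrow> F \<in> U_comp d \<alpha> n \<and> F \<noteq> zero (U_alg d \<alpha>)"

definition U_consequences :: "nat \<Rightarrow> 'k \<times> 'k \<Rightarrow> nat \<Rightarrow> 'k::field gelem set \<Rightarrow> 'k gelem set set" where
  "U_consequences d \<alpha> m F = T_ideal_gen (U_alg d \<alpha>) {F} \<inter> U_comp d \<alpha> m"

definition GL :: "nat \<Rightarrow> (nat \<Rightarrow> nat \<Rightarrow> 'k::field) set" where
  "GL d = {g. \<exists>h. \<forall>i\<in>{1..d}. \<forall>j\<in>{1..d}.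
     (\<Sum>k=1..d. g i k * h k j) = (if i = j then 1 else 0) \<and>
     (\<Sum>k=1..d. h i k * g k j) = (if i = j then 1 else 0)}"

text \<open>
  \<open>\<phi>\<close> is the automorphism by which the matrix \<open>g\<close> acts on \<open>G\<^sub>d\<close>. It is determined on the carrier,
  because \<open>G\<^sub>d\<close> is generated by \<open>x\<^sub>1, \<dots>, x\<^sub>d\<close>.
\<close>

definition GL_acts_by :: "nat \<Rightarrow> (nat \<Rightarrow> nat \<Rightarrow> 'k::field) \<Rightarrow> ('k gelem \<Rightarrow> 'k gelem) \<Rightarrow> bool" where
  "GL_acts_by d g \<phi> \<longleftrightarrow> automorphism (galg d) \<phi> \<and>
     (\<forall>j\<in>{1..d}. \<phi> (gx j) = (\<Sum>i=1..d. gscale (g i j) (gx i)))"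

text \<open>
  As \<open>\<phi>\<close> maps the T-ideal onto itself, the induced action on the factor algebra sends a coset \<open>P\<close>
  to its image \<open>\<phi> ` P\<close>.
\<close>

definition GL_submodule :: "nat \<Rightarrow> 'k \<times> 'k \<Rightarrow> 'k::field gelem set set \<Rightarrow> bool" where
  "GL_submodule d \<alpha> S \<longleftrightarrow> subspace_of (U_alg d \<alpha>) S \<and>
     (\<forall>g\<in>GL d. \<forall>\<phi>. GL_acts_by d g \<phi> \<longrightarrow> (\<forall>P\<in>S. \<phi> ` P \<in> S))"

definition GL_gen :: "nat \<Rightarrow> 'k \<times> 'k \<Rightarrow> 'k::field gelem set set \<Rightarrow> 'k gelem set set" where
  "GL_gen d \<alpha> L = \<Inter>{S. GL_submodule d \<alpha> S \<and> L \<subseteq> S}"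

end

theory Submission
  imports "HOL-Computational_Algebra.Polynomial" Defs
begin

text \<open>
  Write \<open>Y p\<close>, \<open>Z p\<close> for \<^const>\<open>to_y\<close>, \<^const>\<open>to_z\<close>, so that \<open>p q = Y p Z q\<close>, and let \<open>J\<close> be the T-ideal
  of \<open>x (x x)\<close>. Polarising \<open>(Y p)\<^sup>2 Z p \<in> J\<close> shows that \<open>J\<close> contains every monomial of degree at
  least 4 that has degree at least 2 in the \<open>y\<^sub>i\<close>. Conversely \<open>J\<close> lies in the T-ideal \<open>W\<close> of all
  polynomials of degree at least 2 in the \<open>y\<^sub>i\<close>, which is spanned by the products \<open>p (q r)\<close>. So in
  degree \<open>n \<ge> 4\<close> exactly the monomials \<open>y\<^sub>i Z\<^sup>b\<close> survive. They are all obtained from \<open>y\<^sub>2 z\<^sub>1\<^sup>n\<^sup>-\<^sup>1\<close> by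
  taking coefficients of \<open>t\<close> in the images under the transvections \<open>x\<^sub>i \<mapsto> x\<^sub>i + t x\<^sub>j\<close>; this serves
  T-ideals and \<open>GL\<^sub>d\<close>-submodules alike. Finally, substituting \<open>x\<^sub>1 + y\<^sub>2 z\<^sub>1\<close> for \<open>x\<^sub>1\<close> in \<open>w\<^sub>(\<^sub>n\<^sub>)\<close>, or
  \<open>y\<^sub>2 z\<^sub>1\<close> for \<open>x\<^sub>2\<close> in \<open>w\<^sub>(\<^sub>n\<^sub>-\<^sub>1\<^sub>,\<^sub>1\<^sub>)\<close>, yields \<open>y\<^sub>2 z\<^sub>1\<^sup>n\<close> modulo \<open>J\<close>.
\<close>

text \<open>A product \<open>q\<close> satisfies \<open>to_y q = to_z q\<close>. Substituting a
  product for a variable puts the same polynomial into a y-slot and into a z-slot, and the resulting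
  terms differ in y-degree and z-degree; this, together with multiplication by a further factor, is
  what isolates single monomials from the symmetric sums given by polarisation. It costs one degree,
  hence the bound 4. The monomial \<open>yv 2 * zv 1 ^ n\<close> is a good test element for two
  reasons. Its indices differ, so a transvection of x_1 changes the z-variables without touching
  y_2. And it lies outside \<open>W\<close>, so an \<open>f\<close> that forces it into every
  T-ideal above \<open>J\<close> cannot lie in \<open>J\<close>. Consequences are taken in the
  factor algebra, while substitutions are constructed in G_d. For lower bounds this is harmless:
  endomorphisms of G_d descend, so T-ideals of the factor algebra pull back to T-ideals containing
  \<open>J\<close>. The vanishing statement needs the opposite direction, control of all
  endomorphisms of the factor algebra; the products p (q r) give it without lifting. Characteristic
  0 is used to divide by 2, by 3, by exponents, and by differences of powers of 2.\<close>

abbreviation const :: "'k::field \<Rightarrow> 'a::comm_monoid_add \<Rightarrow>\<^sub>0 'k" where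
  "const c \<equiv> Poly_Mapping.single 0 c"

section \<open>Linear extension and monomials\<close>

text \<open>Scalars act as multiplication by constant polynomials, so that linear algebra becomes
  ring algebra for the simplifier. Both \<open>to_y\<close> and \<open>to_z\<close> on linear parts
  and the substitutions \<open>ev\<close> are instances.\<close>

definition lext :: "('m \<Rightarrow> 'a::comm_monoid_add \<Rightarrow>\<^sub>0 'k::field) \<Rightarrow> ('m \<Rightarrow>\<^sub>0 'k) \<Rightarrow> 'a \<Rightarrow>\<^sub>0 'k" where
  "lext v u = (\<Sum>m\<in>Poly_Mapping.keys u. const (Poly_Mapping.lookup u m) * v m)"

lemma const_mult: "const (a * b) = const a * const b"
  by (simp add: mult_single)

lemma lookup_const_mult:
  "Poly_Mapping.lookup (const c * f) m = c * Poly_Mapping.lookup f m"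
proof -
  have "const c * f = Poly_Mapping.map ((*) c) f"
    by (simp add: mult_map_scale_conv_mult)
  then show ?thesis
    by (simp add: map.rep_eq when_def)
qed

lemma keys_const_mult: "Poly_Mapping.keys (const c * f) \<subseteq> Poly_Mapping.keys f"
  by (auto simp: in_keys_iff lookup_const_mult)

lemma lext_zero [simp]: "lext v 0 = 0"
  by (simp add: lext_def)

lemma lext_single [simp]: "lext v (Poly_Mapping.single m c) = const c * v m"
  by (simp add: lext_def)

lemma lext_add: "lext v (u + u') = lext v u + lext v u'"
  unfolding lext_def
  by (rule setsum_keys_plus_distrib) (simp_all add: single_add distrib_right)

lemma lext_superset:
  assumes "finite S" "Poly_Mapping.keys u \<subseteq> S"
  shows "lext v u = (\<Sum>m\<in>S. const (Poly_Mapping.lookup u m) * v m)"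
  unfolding lext_def
  by (rule sum.mono_neutral_left) (use assms in \<open>auto simp: in_keys_iff\<close>)

lemma lext_const_mult: "lext v (const c * u) = const c * lext v u"
  using lext_superset[OF finite_keys keys_const_mult, of v c u]
  by (simp add: lext_def lookup_const_mult const_mult sum_distrib_left mult.assoc)

lemma lext_sum: "lext v (sum g S) = (\<Sum>s\<in>S. lext v (g s))"
  by (induction S rule: infinite_finite_induct) (simp_all add: lext_add)

lemma lext_lext: "lext v (lext w u) = lext (\<lambda>m. lext v (w m)) u"
  by (simp add: lext_def[of w] lext_def[of "\<lambda>m. lext v (w m)"] lext_sum lext_const_mult)

lemma lext_fun_add: "lext (\<lambda>m. v m + w m) u = lext v u + lext w u"
  by (simp add: lext_def distrib_left sum.distrib)

lemma poly_mapping_monomial_sum: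
  "(\<Sum>m\<in>Poly_Mapping.keys u. Poly_Mapping.single m (Poly_Mapping.lookup u m)) = u"
  by (rule poly_mapping_eqI)
    (auto simp: lookup_sum lookup_single when_def in_keys_iff sum.If_cases)

text \<open>Expanding both factors into monomials leaves a double sum in which multiplicativity of
  \<open>v\<close> on monomials is all that is needed.\<close>

lemma lext_mult:
  fixes v :: "'m::comm_monoid_add \<Rightarrow> 'a::comm_monoid_add \<Rightarrow>\<^sub>0 'k::field"
  assumes "\<And>m n. v (m + n) = v m * v n"
  shows "lext v (f * g) = lext v f * lext v g"
proof -
  have "lext v (f * g) = lext v
      ((\<Sum>m\<in>Poly_Mapping.keys f. Poly_Mapping.single m (Poly_Mapping.lookup f m)) *
       (\<Sum>n\<in>Poly_Mapping.keys g. Poly_Mapping.single n (Poly_Mapping.lookup g n)))"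
    by (simp add: poly_mapping_monomial_sum)
  also have "\<dots> = lext v f * lext v g"
    unfolding sum_product lext_sum lext_single mult_single
    unfolding const_mult assms lext_def sum_product by (simp add: mult_ac)
  finally show ?thesis .
qed

definition mpow :: "(nat \<Rightarrow> 'r::comm_monoid_mult) \<Rightarrow> (nat \<Rightarrow>\<^sub>0 nat) \<Rightarrow> 'r" where
  "mpow v a = (\<Prod>i\<in>Poly_Mapping.keys a. v i ^ Poly_Mapping.lookup a i)"

lemma mpow_superset:
  assumes "finite S" "Poly_Mapping.keys a \<subseteq> S"
  shows "mpow v a = (\<Prod>i\<in>S. v i ^ Poly_Mapping.lookup a i)"
  unfolding mpow_def
  by (rule prod.mono_neutral_left) (use assms in \<open>auto simp: in_keys_iff\<close>)

lemma mpow_add: "mpow v (a + b) = mpow v a * mpow v b"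
proof -
  let ?S = "Poly_Mapping.keys a \<union> Poly_Mapping.keys b"
  have "mpow v (a + b) = (\<Prod>i\<in>?S. v i ^ Poly_Mapping.lookup (a + b) i)"
    by (rule mpow_superset) (simp_all add: keys_add)
  moreover have "mpow v a = (\<Prod>i\<in>?S. v i ^ Poly_Mapping.lookup a i)"
    "mpow v b = (\<Prod>i\<in>?S. v i ^ Poly_Mapping.lookup b i)"
    by (rule mpow_superset; simp)+
  ultimately show ?thesis
    by (simp add: lookup_add power_add prod.distrib)
qed

lemma mpow_zero [simp]: "mpow v 0 = 1"
  by (simp add: mpow_def)

lemma mpow_single [simp]: "mpow v (Poly_Mapping.single i n) = v i ^ n"
  by (simp add: mpow_def)

lemma mdeg_add: "mdeg (a + b) = mdeg a + mdeg b"
  unfolding mdeg_def by (rule setsum_keys_plus_distrib) simp_all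

lemma mdeg_zero [simp]: "mdeg 0 = 0"
  by (simp add: mdeg_def)

lemma mdeg_single [simp]: "mdeg (Poly_Mapping.single i n) = n"
  by (simp add: mdeg_def)

lemma exponent_splitE:
  fixes a :: "nat \<Rightarrow>\<^sub>0 nat"
  assumes "i \<in> Poly_Mapping.keys a"
  obtains b where "a = Poly_Mapping.single i 1 + b" "Poly_Mapping.keys b \<subseteq> Poly_Mapping.keys a"
proof
  let ?b = "a - Poly_Mapping.single i 1"
  show "a = Poly_Mapping.single i 1 + ?b"
    using assms
    by (intro poly_mapping_eqI) (auto simp: lookup_add lookup_minus lookup_single when_def in_keys_iff)
  show "Poly_Mapping.keys ?b \<subseteq> Poly_Mapping.keys a"
    by (auto simp: in_keys_iff lookup_minus)
qed

lemma mdeg_pos_splitE: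
  assumes "mdeg a \<ge> 1"
  obtains i b where "a = Poly_Mapping.single i 1 + b" "i \<in> Poly_Mapping.keys a"
    "Poly_Mapping.keys b \<subseteq> Poly_Mapping.keys a" "mdeg a = Suc (mdeg b)"
proof -
  from assms have "Poly_Mapping.keys a \<noteq> {}"
    by (auto simp: mdeg_def)
  then obtain i where i: "i \<in> Poly_Mapping.keys a" by blast
  with exponent_splitE obtain b
    where b: "a = Poly_Mapping.single i 1 + b" "Poly_Mapping.keys b \<subseteq> Poly_Mapping.keys a"
    by blast
  moreover have "mdeg a = Suc (mdeg b)"
    by (subst b(1)) (simp add: mdeg_add)
  ultimately show thesis using i that by blast
qed

lemma YZ_mult: "YZ a b * YZ c e = YZ (a + c) (b + e)"
  by (simp add: YZ_def mult_single)

lemma yv_YZ: "yv i * YZ a b = YZ (Poly_Mapping.single i 1 + a) b"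
  by (simp add: yv_def YZ_mult)

lemma zv_YZ: "zv i * YZ a b = YZ a (Poly_Mapping.single i 1 + b)"
  by (simp add: zv_def YZ_mult)

section \<open>The algebra \<open>G\<^sub>d\<close>\<close>

abbreviation G :: "nat \<Rightarrow> 'k::field gelem set" where
  "G d \<equiv> carrier (galg d)"

lemma galg_simps [simp]:
  "zero (galg d) = 0" "add (galg d) = (+)" "scale (galg d) = gscale" "mult (galg d) = gmult"
  by (simp_all add: galg_def)

lemma gscale_conv: "gscale c p = (const c * fst p, const c * snd p)"
  by (simp add: gscale_def mult_map_scale_conv_mult)

lemma gscale_gpoly: "gscale c (gpoly f) = gpoly (const c * f)"
  by (simp add: gscale_conv gpoly_def)

lemma gscale_minus_one: "gscale (-1) p = - p"
  by (cases p) (simp add: gscale_conv single_uminus)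

lemma gscale_one [simp]: "gscale 1 p = p"
  by (simp add: gscale_conv)

lemma gscale_gscale: "gscale a (gscale b p) = gscale (a * b) p"
  by (simp add: gscale_conv const_mult mult.assoc)

lemma gscale_diff: "gscale c (p - q) = gscale c p - gscale c q"
  by (simp add: gscale_conv right_diff_distrib)

lemma gscale_zero [simp]: "gscale c 0 = 0"
  by (simp add: gscale_conv zero_prod_def)

lemma gscale_zero_left: "gscale 0 p = 0"
  by (simp add: gscale_conv zero_prod_def)

lemma gpoly_add: "gpoly (f + g) = gpoly f + gpoly g"
  by (simp add: gpoly_def)

lemma gpoly_diff: "gpoly (f - g) = gpoly f - gpoly g"
  by (simp add: gpoly_def)

lemma gpoly_uminus: "gpoly (- f) = - gpoly f"
  by (simp add: gpoly_def)

lemma gpoly_zero [simp]: "gpoly 0 = 0"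
  by (simp add: gpoly_def zero_prod_def)

lemma to_y_conv: "to_y p = lext yv (fst p) + snd p"
  by (simp add: to_y_def lext_def yv_def YZ_def mult_single)

lemma to_z_conv: "to_z p = lext zv (fst p) + snd p"
  by (simp add: to_z_def lext_def zv_def YZ_def mult_single)

lemma to_y_simps [simp]:
  "to_y (p + q) = to_y p + to_y q" "to_y (gscale c p) = const c * to_y p"
  "to_y (gpoly f) = f" "to_y (gx i) = yv i" "to_y 0 = 0"
  by (simp_all add: to_y_conv lext_add gscale_conv lext_const_mult distrib_left add_ac gpoly_def gx_def)

lemma to_z_simps [simp]:
  "to_z (p + q) = to_z p + to_z q" "to_z (gscale c p) = const c * to_z p"
  "to_z (gpoly f) = f" "to_z (gx i) = zv i" "to_z 0 = 0"
  by (simp_all add: to_z_conv lext_add gscale_conv lext_const_mult distrib_left add_ac gpoly_def gx_def)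

lemma gmult_add:
  "gmult (p + q) r = gmult p r + gmult q r" "gmult p (q + r) = gmult p q + gmult p r"
  by (simp_all add: gmult_def algebra_simps gpoly_add)

text \<open>One predicate with two lower bounds covers all sets in play: (1,1) describes the
  polynomial part of G_d, (2,1) the set \<open>W\<close>, (1,0) and (0,1) the values of
  \<open>to_y\<close> and \<open>to_z\<close>, while (3,1) and (2,2) turn out to force membership in
  \<open>J\<close>. The bounds add under multiplication.\<close>

definition yz_bounded :: "nat \<Rightarrow> nat \<Rightarrow> nat \<Rightarrow> 'k::field yzpoly \<Rightarrow> bool" where
  "yz_bounded d i j f \<longleftrightarrow> (\<forall>(a, b)\<in>Poly_Mapping.keys f.
     Poly_Mapping.keys a \<subseteq> {1..d} \<and> Poly_Mapping.keys b \<subseteq> {1..d} \<and> i \<le> mdeg a \<and> j \<le> mdeg b)"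

definition homog :: "nat \<Rightarrow> 'k::field yzpoly \<Rightarrow> bool" where
  "homog n f \<longleftrightarrow> (\<forall>(a, b)\<in>Poly_Mapping.keys f. mdeg a + mdeg b = n)"

lemma in_G_iff: "p \<in> G d \<longleftrightarrow> Poly_Mapping.keys (fst p) \<subseteq> {1..d} \<and> yz_bounded d 1 1 (snd p)"
  by (auto simp: galg_def yz_bounded_def)

lemma in_gcomp_iff:
  "p \<in> gcomp d n \<longleftrightarrow> p \<in> G d \<and> (n \<noteq> 1 \<longrightarrow> fst p = 0) \<and> homog n (snd p)"
  by (auto simp: gcomp_def homog_def)

lemma yz_bounded_zero [simp]: "yz_bounded d i j 0"
  by (simp add: yz_bounded_def)

lemma yz_bounded_add:
  assumes "yz_bounded d i j f" "yz_bounded d i j g"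
  shows "yz_bounded d i j (f + g)"
  using assms keys_add[of f g] unfolding yz_bounded_def by fast

lemma yz_bounded_mult:
  assumes "yz_bounded d i j f" "yz_bounded d k l g"
  shows "yz_bounded d (i + k) (j + l) (f * g)"
  unfolding yz_bounded_def
proof clarify
  fix a b assume "(a, b) \<in> Poly_Mapping.keys (f * g)"
  then obtain a1 b1 a2 b2 where ab: "(a1, b1) \<in> Poly_Mapping.keys f" "(a2, b2) \<in> Poly_Mapping.keys g"
    "a = a1 + a2" "b = b1 + b2"
    using keys_mult[of f g] by (force simp: plus_prod_def)
  with assms have *: "Poly_Mapping.keys a1 \<subseteq> {1..d}" "Poly_Mapping.keys b1 \<subseteq> {1..d}"
    "Poly_Mapping.keys a2 \<subseteq> {1..d}" "Poly_Mapping.keys b2 \<subseteq> {1..d}"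
    "i \<le> mdeg a1" "j \<le> mdeg b1" "k \<le> mdeg a2" "l \<le> mdeg b2"
    unfolding yz_bounded_def by fast+
  have "Poly_Mapping.keys a \<subseteq> {1..d}" "Poly_Mapping.keys b \<subseteq> {1..d}"
    using * keys_add[of a1 a2] keys_add[of b1 b2] unfolding ab by blast+
  then show "Poly_Mapping.keys a \<subseteq> {1..d} \<and> Poly_Mapping.keys b \<subseteq> {1..d} \<and> i + k \<le> mdeg a \<and> j + l \<le> mdeg b"
    using * by (simp add: ab mdeg_add)
qed

lemma yz_bounded_mono:
  assumes "yz_bounded d i j f" "i' \<le> i" "j' \<le> j"
  shows "yz_bounded d i' j' f"
  using assms unfolding yz_bounded_def by fastforce

lemma yz_bounded_const_mult:
  assumes "yz_bounded d i j f"
  shows "yz_bounded d i j (const c * f)"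
  using assms keys_const_mult[of c f] unfolding yz_bounded_def by blast

lemma yz_bounded_const: "yz_bounded d 0 0 (const c)"
  by (simp add: yz_bounded_def zero_prod_def)

lemma yz_bounded_sum:
  assumes "\<And>s. s \<in> S \<Longrightarrow> yz_bounded d i j (g s)"
  shows "yz_bounded d i j (sum g S)"
  using assms by (induction S rule: infinite_finite_induct) (auto intro: yz_bounded_add)

lemma yz_bounded_uminus: "yz_bounded d i j (- f) \<longleftrightarrow> yz_bounded d i j f"
  by (simp add: yz_bounded_def)

lemma yz_bounded_diff:
  assumes "yz_bounded d i j f" "yz_bounded d i j g"
  shows "yz_bounded d i j (f - g)"
  using yz_bounded_add[of d i j f "- g"] assms by (simp add: yz_bounded_uminus)

lemma yz_bounded_YZ:
  "yz_bounded d i j (YZ a b :: 'k::field yzpoly) \<longleftrightarrow>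
     Poly_Mapping.keys a \<subseteq> {1..d} \<and> Poly_Mapping.keys b \<subseteq> {1..d} \<and> i \<le> mdeg a \<and> j \<le> mdeg b"
  by (simp add: yz_bounded_def YZ_def)

lemma yz_bounded_monomial:
  fixes f :: "'k::field yzpoly"
  assumes "yz_bounded d i j f" "(a, b) \<in> Poly_Mapping.keys f"
  shows "yz_bounded d i j (YZ a b :: 'k yzpoly)"
  using bspec[OF assms(1)[unfolded yz_bounded_def] assms(2)] by (simp add: yz_bounded_YZ)

lemma yz_bounded_var:
  assumes "i \<in> {1..d}"
  shows "yz_bounded d 1 0 (yv i :: 'k::field yzpoly)" "yz_bounded d 0 1 (zv i :: 'k::field yzpoly)"
  using assms by (simp_all add: yv_def zv_def yz_bounded_YZ)

lemma yz_bounded_one: "yz_bounded d 0 0 (1 :: 'k::field yzpoly)"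
  using yz_bounded_const[of d 1] by simp

lemma yz_bounded_power:
  assumes "yz_bounded d i j f"
  shows "yz_bounded d (n * i) (n * j) (f ^ n)"
  by (induction n) (auto simp: yz_bounded_one intro: yz_bounded_mult assms)

lemma yz_bounded_mpow:
  assumes "\<And>i. i \<in> Poly_Mapping.keys a \<Longrightarrow> yz_bounded d k l (v i)"
  shows "yz_bounded d (mdeg a * k) (mdeg a * l) (mpow v a)"
proof -
  have "yz_bounded d ((\<Sum>i\<in>S. Poly_Mapping.lookup a i) * k) ((\<Sum>i\<in>S. Poly_Mapping.lookup a i) * l)
     (\<Prod>i\<in>S. v i ^ Poly_Mapping.lookup a i)" if "S \<subseteq> Poly_Mapping.keys a" for S
    using finite_subset[OF that finite_keys] that
  proof (induction S rule: finite_induct)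
    case (insert i S)
    then show ?case
      using yz_bounded_mult[OF yz_bounded_power[OF assms[of i], of "Poly_Mapping.lookup a i"]]
      by (simp add: add_mult_distrib)
  qed (simp add: yz_bounded_one)
  then show ?thesis by (simp add: mpow_def mdeg_def)
qed

lemma yz_bounded_lext:
  assumes "\<And>m. m \<in> Poly_Mapping.keys u \<Longrightarrow> yz_bounded d i j (v m)"
  shows "yz_bounded d i j (lext v u)"
  unfolding lext_def by (intro yz_bounded_sum yz_bounded_const_mult assms)

lemma homog_zero [simp]: "homog n 0"
  by (simp add: homog_def)

lemma homog_add: "homog n f \<Longrightarrow> homog n g \<Longrightarrow> homog n (f + g)"
  using keys_add[of f g] unfolding homog_def by fast

lemma homog_const_mult: "homog n f \<Longrightarrow> homog n (const c * f)"
  using keys_const_mult[of c f] unfolding homog_def by blast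

lemma homog_sum:
  assumes "\<And>s. s \<in> S \<Longrightarrow> homog n (g s)"
  shows "homog n (sum g S)"
  using assms by (induction S rule: infinite_finite_induct) (auto intro: homog_add)

lemma homog_uminus: "homog n (- f) \<longleftrightarrow> homog n f"
  by (simp add: homog_def)

lemma homog_diff: "homog n f \<Longrightarrow> homog n g \<Longrightarrow> homog n (f - g)"
  using homog_add[of n f "- g"] by (simp add: homog_uminus)

lemma homog_mult:
  assumes "homog n f" "homog m g"
  shows "homog (n + m) (f * g)"
  unfolding homog_def
proof clarify
  fix a b assume "(a, b) \<in> Poly_Mapping.keys (f * g)"
  then obtain a1 b1 a2 b2 where ab: "(a1, b1) \<in> Poly_Mapping.keys f" "(a2, b2) \<in> Poly_Mapping.keys g"
    "a = a1 + a2" "b = b1 + b2"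
    using keys_mult[of f g] by (force simp: plus_prod_def)
  with assms have "mdeg a1 + mdeg b1 = n" "mdeg a2 + mdeg b2 = m"
    unfolding homog_def by fast+
  then show "mdeg a + mdeg b = n + m"
    by (simp add: ab mdeg_add)
qed

lemma homog_YZ: "homog n (YZ a b :: 'k::field yzpoly) \<longleftrightarrow> mdeg a + mdeg b = n"
  by (simp add: homog_def YZ_def)

lemma homog_var: "homog 1 (yv i :: 'k::field yzpoly)" "homog 1 (zv i :: 'k::field yzpoly)"
  by (simp_all add: yv_def zv_def homog_YZ)

lemma homog_power: "homog n f \<Longrightarrow> homog (m * n) (f ^ m)"
proof (induction m)
  case 0
  show ?case by (simp add: homog_def zero_prod_def)
qed (simp add: homog_mult)

lemma yz_bounded_to_y: "p \<in> G d \<Longrightarrow> yz_bounded d 1 0 (to_y p)"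
  unfolding to_y_conv
  by (intro yz_bounded_add yz_bounded_lext)
    (auto simp: in_G_iff simp del: One_nat_def intro: yz_bounded_var yz_bounded_mono)

lemma yz_bounded_to_z: "p \<in> G d \<Longrightarrow> yz_bounded d 0 1 (to_z p)"
  unfolding to_z_conv
  by (intro yz_bounded_add yz_bounded_lext)
    (auto simp: in_G_iff simp del: One_nat_def intro: yz_bounded_var yz_bounded_mono)

lemma gpoly_in_G_iff: "gpoly f \<in> G d \<longleftrightarrow> yz_bounded d 1 1 f"
  by (simp add: in_G_iff gpoly_def)

lemma gx_in_G: "i \<in> {1..d} \<Longrightarrow> gx i \<in> G d"
  by (simp add: in_G_iff gx_def)

lemma zero_in_G: "0 \<in> G d"
  by (simp add: in_G_iff)

lemma add_in_G: "p \<in> G d \<Longrightarrow> q \<in> G d \<Longrightarrow> p + q \<in> G d"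
  using keys_add[of "fst p" "fst q"] by (auto simp: in_G_iff intro: yz_bounded_add)

lemma gscale_in_G: "p \<in> G d \<Longrightarrow> gscale c p \<in> G d"
  using keys_const_mult[of c "fst p"] by (auto simp: in_G_iff gscale_conv intro: yz_bounded_const_mult)

lemma gmult_in_G: "p \<in> G d \<Longrightarrow> q \<in> G d \<Longrightarrow> gmult p q \<in> G d"
  using yz_bounded_mult[OF yz_bounded_to_y yz_bounded_to_z, of p d q]
  by (simp add: gmult_def gpoly_in_G_iff)

lemma ideal_G: "ideal_of (galg d) (G d)"
  by (simp add: ideal_of_def subspace_of_def zero_in_G add_in_G gscale_in_G gmult_in_G)

lemma T_ideal_G: "T_ideal (galg d) (G d)"
  by (auto simp: T_ideal_def ideal_G endomorphism_def)

lemma gcomp_subset: "gcomp d n \<subseteq> G d"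
  by (auto simp: in_gcomp_iff)

lemma subspace_gcomp: "subspace_of (galg d) (gcomp d n)"
  unfolding subspace_of_def
proof (intro conjI ballI allI gcomp_subset)
  show "scale (galg d) c p \<in> gcomp d n" if "p \<in> gcomp d n" for c :: 'a and p
    using that gscale_in_G[of p d c] by (simp add: in_gcomp_iff) (simp add: gscale_conv homog_const_mult)
qed (auto simp: in_gcomp_iff zero_in_G add_in_G homog_add)

text \<open>Every monomial of G_d has degree at least 1 in y and at least 1 in z, so none has total
  degree 1.\<close>

lemma gcomp_one_snd:
  assumes "p \<in> gcomp d 1"
  shows "snd p = 0"
proof -
  have "Poly_Mapping.keys (snd p) = {}"
    using assms by (fastforce simp: in_gcomp_iff in_G_iff yz_bounded_def homog_def)
  then show ?thesis by simp
qed

lemma homog_to_yz: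
  assumes "p \<in> gcomp d n" shows "homog n (to_y p)" "homog n (to_z p)"
proof -
  have "homog n (lext v (fst p))" if "\<And>i. homog 1 (v i :: 'a yzpoly)" for v
    using assms that
    by (cases "n = 1") (auto simp: in_gcomp_iff lext_def intro!: homog_sum homog_const_mult)
  from this[OF homog_var(1)] this[OF homog_var(2)] assms
  show "homog n (to_y p)" "homog n (to_z p)"
    by (auto simp: to_y_conv to_z_conv in_gcomp_iff intro!: homog_add)
qed

lemma gmult_in_gcomp:
  assumes "p \<in> gcomp d n" "q \<in> gcomp d m" "n \<ge> 1" "m \<ge> 1"
  shows "gmult p q \<in> gcomp d (n + m)"
  using assms gmult_in_G[of p d q] homog_mult[OF homog_to_yz(1) homog_to_yz(2), of p d n q d m]
  by (auto simp: in_gcomp_iff gmult_def gpoly_def)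

lemma gx_in_gcomp: "i \<in> {1..d} \<Longrightarrow> gx i \<in> gcomp d 1"
  using gx_in_G[of i d] by (simp add: in_gcomp_iff gx_def)

lemma gpoly_in_gcomp_iff: "gpoly f \<in> gcomp d n \<longleftrightarrow> yz_bounded d 1 1 f \<and> homog n f"
  by (auto simp: in_gcomp_iff gpoly_in_G_iff) (auto simp: gpoly_def)

text \<open>This is the induction step for generation by the x_i. If the y-degree exceeds 1, some
  x_i splits off on the left; if it is 1 and the z-degree exceeds 1, some x_j splits off on the
  right; what remains is x_i x_j. Both factors have smaller degree.\<close>

lemma YZ_is_product:
  assumes "Poly_Mapping.keys a \<subseteq> {1..d}" "Poly_Mapping.keys b \<subseteq> {1..d}" "1 \<le> mdeg a" "1 \<le> mdeg b"
  obtains r s n m where "gpoly (YZ a b :: 'k::field yzpoly) = gmult r s" "r \<in> gcomp d n" "s \<in> gcomp d m"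
    "1 \<le> n" "1 \<le> m" "n + m = mdeg a + mdeg b"
proof -
  from mdeg_pos_splitE[OF assms(3)] obtain i a' where a: "a = Poly_Mapping.single i 1 + a'"
    "i \<in> Poly_Mapping.keys a" "Poly_Mapping.keys a' \<subseteq> Poly_Mapping.keys a" "mdeg a = Suc (mdeg a')" by blast
  from mdeg_pos_splitE[OF assms(4)] obtain j b' where b: "b = Poly_Mapping.single j 1 + b'"
    "j \<in> Poly_Mapping.keys b" "Poly_Mapping.keys b' \<subseteq> Poly_Mapping.keys b" "mdeg b = Suc (mdeg b')" by blast
  have ij: "gx i \<in> gcomp d 1" "gx j \<in> gcomp d 1"
    using a(2) b(2) assms by (auto simp del: One_nat_def intro!: gx_in_gcomp)
  show thesis
  proof (cases "mdeg a' = 0")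
    case False
    have "gpoly (YZ a b :: 'k yzpoly) = gmult (gx i) (gpoly (YZ a' b))"
      by (subst a(1)) (simp add: gmult_def yv_YZ)
    moreover have "gpoly (YZ a' b :: 'k yzpoly) \<in> gcomp d (mdeg a' + mdeg b)"
      using assms a False by (auto simp: gpoly_in_gcomp_iff yz_bounded_YZ homog_YZ)
    ultimately show thesis using ij a False by (intro that[of "gx i"]) auto
  next
    case a0: True
    then have a'0: "a' = 0"
      using mdeg_pos_splitE[of a'] by (auto simp: mdeg_def in_keys_iff intro!: poly_mapping_eqI)
    show thesis
    proof (cases "mdeg b' = 0")
      case False
      have "gpoly (YZ a b :: 'k yzpoly) = gmult (gpoly (YZ a b')) (gx j)"
        by (subst b(1)) (simp add: gmult_def mult.commute[of "YZ a b'"] zv_YZ)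
      moreover have "gpoly (YZ a b' :: 'k yzpoly) \<in> gcomp d (mdeg a + mdeg b')"
        using assms b False by (auto simp: gpoly_in_gcomp_iff yz_bounded_YZ homog_YZ)
      ultimately show thesis using ij b a False by (intro that[of _ "gx j"]) auto
    next
      case True
      then have "b' = 0"
        by (auto simp: mdeg_def in_keys_iff intro!: poly_mapping_eqI)
      with a'0 a(1) b(1) have "gpoly (YZ a b :: 'k yzpoly) = gmult (gx i) (gx j)"
        by (simp add: gmult_def yv_def zv_def YZ_mult)
      with ij a b a0 True show thesis by (intro that[of "gx i" "gx j" 1 1]) auto
    qed
  qed
qed

section \<open>Spanning by monomials and generation by x_1, ..., x_d\<close>

lemma subspace_sum:
  assumes "subspace_of (galg d) S" "\<And>i. i \<in> I \<Longrightarrow> g i \<in> S"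
  shows "sum g I \<in> S"
  using assms by (induction I rule: infinite_finite_induct) (auto simp: subspace_of_def)

lemma gpoly_sum: "gpoly (sum g I) = (\<Sum>i\<in>I. gpoly (g i))"
  by (induction I rule: infinite_finite_induct) (simp_all add: gpoly_add)

lemma gpoly_in_subspaceI:
  assumes "subspace_of (galg d) S"
    and "\<And>a b. (a, b) \<in> Poly_Mapping.keys f \<Longrightarrow> gpoly (YZ a b) \<in> S"
  shows "gpoly f \<in> S"
proof -
  have "gpoly f = (\<Sum>m\<in>Poly_Mapping.keys f. gscale (Poly_Mapping.lookup f m) (gpoly (YZ (fst m) (snd m))))"
    unfolding gscale_gpoly gpoly_sum[symmetric]
    by (simp add: YZ_def mult_single poly_mapping_monomial_sum)
  also have "\<dots> \<in> S"
    using assms by (intro subspace_sum[OF assms(1)]) (auto simp: subspace_of_def)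
  finally show ?thesis .
qed

lemma gelem_linear_part: "(u, 0) = (\<Sum>i\<in>Poly_Mapping.keys u. gscale (Poly_Mapping.lookup u i) (gx i))"
proof -
  have "(\<Sum>i\<in>I. gscale (Poly_Mapping.lookup u i) (gx i)) =
      (\<Sum>i\<in>I. Poly_Mapping.single i (Poly_Mapping.lookup u i), 0)" for I
    by (induction I rule: infinite_finite_induct)
      (auto simp: gscale_conv gx_def mult_single zero_prod_def)
  then show ?thesis by (simp add: poly_mapping_monomial_sum)
qed

lemma gelem_split: "p = (fst p, 0) + gpoly (snd p)"
  by (simp add: gpoly_def)

lemma G_subset_subspaceI:
  fixes S :: "'k::field gelem set"
  assumes S: "subspace_of (galg d) S"
    and gen: "\<And>i. i \<in> {1..d} \<Longrightarrow> gx i \<in> S"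
    and mon: "\<And>a b. gpoly (YZ a b :: 'k yzpoly) \<in> G d \<Longrightarrow> gpoly (YZ a b) \<in> S"
  shows "G d \<subseteq> S"
proof
  fix p :: "'k gelem" assume p: "p \<in> G d"
  have "(fst p, 0) \<in> S"
    unfolding gelem_linear_part using p S gen
    by (intro subspace_sum[OF S]) (auto simp: subspace_of_def in_G_iff)
  moreover have "gpoly (snd p) \<in> S"
  proof (rule gpoly_in_subspaceI[OF S])
    show "gpoly (YZ a b) \<in> S" if "(a, b) \<in> Poly_Mapping.keys (snd p)" for a b
      using p that by (intro mon) (simp add: gpoly_in_G_iff, simp add: in_G_iff, blast intro: yz_bounded_monomial)
  qed
  ultimately show "p \<in> S"
    using S by (subst gelem_split[of p]) (simp add: subspace_of_def)
qed

text \<open>Strong induction on the degree through \<open>YZ_is_product\<close>. A constant family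
  \<open>S\<close> gives generation as an algebra; a family depending on \<open>n\<close> shows that
  linear substitutions preserve degrees.\<close>

lemma gcomp_subset_gradedI:
  fixes S :: "nat \<Rightarrow> 'k::field gelem set"
  assumes S: "\<And>n. subspace_of (galg d) (S n)"
    and gen: "\<And>i. i \<in> {1..d} \<Longrightarrow> gx i \<in> S 1"
    and mul: "\<And>n m r s. r \<in> S n \<Longrightarrow> s \<in> S m \<Longrightarrow> gmult r s \<in> S (n + m)"
  shows "gcomp d n \<subseteq> S n"
proof (induction n rule: less_induct)
  case (less n)
  show ?case
  proof
    fix p :: "'k gelem" assume p: "p \<in> gcomp d n"
    show "p \<in> S n"
    proof (cases "n = 1")
      case True
      with p have "p = (fst p, 0)"
        by (metis gcomp_one_snd prod.collapse)
      moreover have "Poly_Mapping.keys (fst p) \<subseteq> {1..d}"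
        using p by (simp add: in_gcomp_iff in_G_iff)
      moreover have "(\<Sum>i\<in>Poly_Mapping.keys (fst p). gscale (Poly_Mapping.lookup (fst p) i) (gx i)) \<in> S n"
        using S[of n] gen True calculation(2) by (intro subspace_sum[OF S]) (auto simp: subspace_of_def)
      ultimately show ?thesis using gelem_linear_part[of "fst p"] by simp
    next
      case False
      with p have eq: "p = gpoly (snd p)" by (simp add: in_gcomp_iff gpoly_def prod_eq_iff)
      have "gpoly (snd p) \<in> S n"
      proof (rule gpoly_in_subspaceI[OF S])
        fix a b assume ab: "(a, b) \<in> Poly_Mapping.keys (snd p)"
        with p have "yz_bounded d 1 1 (YZ a b :: 'k yzpoly)" and n: "mdeg a + mdeg b = n"
          using yz_bounded_monomial[of d 1 1 "snd p" a b] by (auto simp: in_gcomp_iff in_G_iff homog_def)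
        then obtain r s k l where *: "gpoly (YZ a b :: 'k yzpoly) = gmult r s"
          "r \<in> gcomp d k" "s \<in> gcomp d l" "1 \<le> k" "1 \<le> l" "k + l = n"
          unfolding yz_bounded_YZ by (metis YZ_is_product)
        then have "r \<in> S k" "s \<in> S l" using less[of k] less[of l] by auto
        with * mul show "gpoly (YZ a b :: 'k yzpoly) \<in> S n" by metis
      qed
      with eq show ?thesis by simp
    qed
  qed
qed

lemma G_subset_subalgebraI:
  fixes S :: "'k::field gelem set"
  assumes S: "subspace_of (galg d) S"
    and gen: "\<And>i. i \<in> {1..d} \<Longrightarrow> gx i \<in> S"
    and mul: "\<And>r s. r \<in> S \<Longrightarrow> s \<in> S \<Longrightarrow> gmult r s \<in> S"
  shows "G d \<subseteq> S"
proof (rule G_subset_subspaceI[OF S gen])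
  fix a b assume "gpoly (YZ a b :: 'k yzpoly) \<in> G d"
  then have "gpoly (YZ a b :: 'k yzpoly) \<in> gcomp d (mdeg a + mdeg b)"
    by (auto simp: gpoly_in_G_iff gpoly_in_gcomp_iff homog_YZ)
  then show "gpoly (YZ a b :: 'k yzpoly) \<in> S"
    using gcomp_subset_gradedI[of d "\<lambda>_. S"] S gen mul by auto
qed

section \<open>Endomorphisms of \<open>G\<^sub>d\<close>\<close>

lemma endomorphism_galgD:
  assumes "endomorphism (galg d) \<phi>"
  shows "p \<in> G d \<Longrightarrow> \<phi> p \<in> G d" "p \<in> G d \<Longrightarrow> q \<in> G d \<Longrightarrow> \<phi> (p + q) = \<phi> p + \<phi> q"
    "p \<in> G d \<Longrightarrow> \<phi> (gscale c p) = gscale c (\<phi> p)"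
    "p \<in> G d \<Longrightarrow> q \<in> G d \<Longrightarrow> \<phi> (gmult p q) = gmult (\<phi> p) (\<phi> q)" "\<phi> 0 = 0"
proof -
  show *: "p \<in> G d \<Longrightarrow> \<phi> p \<in> G d" "p \<in> G d \<Longrightarrow> q \<in> G d \<Longrightarrow> \<phi> (p + q) = \<phi> p + \<phi> q"
    "p \<in> G d \<Longrightarrow> \<phi> (gscale c p) = gscale c (\<phi> p)"
    "p \<in> G d \<Longrightarrow> q \<in> G d \<Longrightarrow> \<phi> (gmult p q) = gmult (\<phi> p) (\<phi> q)" for p q c
    using assms by (auto simp: endomorphism_def)
  show "\<phi> 0 = 0" using *(2)[OF zero_in_G zero_in_G] by simp
qed

lemma subspace_vimage:
  assumes \<phi>: "endomorphism (galg d) \<phi>" and S: "subspace_of (galg d) S"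
  shows "subspace_of (galg d) {p \<in> G d. \<phi> p \<in> S}"
  using S by (auto simp: subspace_of_def zero_in_G add_in_G gscale_in_G endomorphism_galgD[OF \<phi>])

text \<open>The uniqueness half of freeness: the equaliser of two endomorphisms is a subalgebra. The
  existence half is \<open>endomorphism_ghom\<close>.\<close>

lemma endomorphism_eq_on_G:
  assumes \<phi>: "endomorphism (galg d) \<phi>" and \<psi>: "endomorphism (galg d) \<psi>"
    and "\<And>i. i \<in> {1..d} \<Longrightarrow> \<phi> (gx i) = \<psi> (gx i)" "p \<in> G d"
  shows "\<phi> p = \<psi> p"
proof -
  have "G d \<subseteq> {p \<in> G d. \<phi> p = \<psi> p}"
    using assms(3)
    by (intro G_subset_subalgebraI)
      (auto simp: subspace_of_def zero_in_G add_in_G gscale_in_G gmult_in_G gx_in_G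
        endomorphism_galgD[OF \<phi>] endomorphism_galgD[OF \<psi>] simp del: One_nat_def)
  with assms(4) show ?thesis by blast
qed

lemma endomorphism_gcomp:
  assumes \<phi>: "endomorphism (galg d) \<phi>" and gen: "\<And>i. i \<in> {1..d} \<Longrightarrow> \<phi> (gx i) \<in> gcomp d 1"
    and p: "p \<in> gcomp d n"
  shows "\<phi> p \<in> gcomp d n"
proof (cases "n = 0")
  case True
  have "(a, b) \<notin> Poly_Mapping.keys (snd p)" for a b
    using p True yz_bounded_monomial[of d 1 1 "snd p" a b]
    by (auto simp: in_gcomp_iff in_G_iff yz_bounded_YZ homog_def)
  then have "snd p = 0" by (intro poly_mapping_eqI) (auto simp: in_keys_iff)
  with p True have "p = 0" by (simp add: prod_eq_iff in_gcomp_iff)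
  with p show ?thesis by (simp add: endomorphism_galgD(5)[OF \<phi>])
next
  case False
  \<comment> \<open>Degree 0 is replaced by \<open>{0}\<close> because \<open>gmult_in_gcomp\<close>
    speaks of positive degrees only.\<close>
  let ?S = "\<lambda>n. if n = 0 then {0} else {p \<in> G d. \<phi> p \<in> gcomp d n}"
  have "gcomp d n \<subseteq> ?S n"
  proof (rule gcomp_subset_gradedI)
    show "subspace_of (galg d) (?S n)" for n
      using subspace_vimage[OF \<phi> subspace_gcomp] by (auto simp: subspace_of_def zero_in_G)
    show "gx i \<in> ?S 1" if "i \<in> {1..d}" for i
      using that gen gx_in_G by auto
    show "gmult r s \<in> ?S (n + m)" if "r \<in> ?S n" "s \<in> ?S m" for r s n m
    proof (cases "n = 0 \<or> m = 0")
      case True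
      with that have "gmult r s = 0" by (auto simp: gmult_def)
      then show ?thesis
        using subspace_vimage[OF \<phi> subspace_gcomp] by (auto simp: subspace_of_def)
    next
      case False
      with that show ?thesis
        by (auto simp: gmult_in_G endomorphism_galgD[OF \<phi>] gmult_in_gcomp)
    qed
  qed
  with p False show ?thesis by auto
qed

section \<open>Substitution endomorphisms\<close>

definition ev :: "(nat \<Rightarrow> 'k::field gelem) \<Rightarrow> 'k yzpoly \<Rightarrow> 'k yzpoly" where
  "ev p = lext (\<lambda>(a, b). mpow (\<lambda>i. to_y (p i)) a * mpow (\<lambda>i. to_z (p i)) b)"

text \<open>The linear part of \<open>q\<close> is sent to a combination of the \<open>p i\<close>,
  each of which has a linear and a polynomial component; the polynomial part of \<open>q\<close> is
  evaluated at y_i = \<open>to_y (p i)\<close>, z_i = \<open>to_z (p i)\<close>.\<close>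

definition ghom :: "(nat \<Rightarrow> 'k::field gelem) \<Rightarrow> 'k gelem \<Rightarrow> 'k gelem" where
  "ghom p q = (lext (\<lambda>i. fst (p i)) (fst q), lext (\<lambda>i. snd (p i)) (fst q) + ev p (snd q))"

lemma ev_add: "ev p (f + g) = ev p f + ev p g"
  by (simp add: ev_def lext_add)

lemma ev_mult: "ev p (f * g) = ev p f * ev p g"
  unfolding ev_def by (rule lext_mult) (auto simp: mpow_add mult_ac split: prod.splits)

lemma ev_const: "ev p (const c) = const c"
  by (simp add: ev_def zero_prod_def)

lemma ev_uminus: "ev p (- f) = - ev p f"
  using ev_add[of p "- f" f] by (simp add: ev_def eq_neg_iff_add_eq_0)

lemma ev_diff: "ev p (f - g) = ev p f - ev p g"
  using ev_add[of p f "- g"] by (simp add: ev_uminus)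

lemma ev_one: "ev p 1 = 1"
  using ev_const[of p 1] by simp

lemma ev_power: "ev p (f ^ n) = ev p f ^ n"
  by (induction n) (simp_all add: ev_mult ev_one)

lemma ev_yv [simp]: "ev p (yv i) = to_y (p i)"
  by (simp add: ev_def yv_def YZ_def)

lemma ev_zv [simp]: "ev p (zv i) = to_z (p i)"
  by (simp add: ev_def zv_def YZ_def)

lemmas ev_simps = ev_add ev_mult ev_const ev_diff ev_uminus ev_one ev_power

lemma ev_lext: "ev p (lext v u) = lext (\<lambda>i. ev p (v i)) u"
  by (simp add: ev_def lext_lext)

text \<open>The product of G_d sees its factors only through \<open>to_y\<close> and
  \<open>to_z\<close>. This intertwining, with its companion for \<open>to_z\<close>, therefore
  reduces multiplicativity of \<open>ghom p\<close> to that of \<open>ev p\<close>.\<close>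

lemma to_y_ghom: "to_y (ghom p q) = ev p (to_y q)"
  by (simp add: ghom_def to_y_conv lext_lext ev_add ev_lext lext_fun_add add_ac)

lemma to_z_ghom: "to_z (ghom p q) = ev p (to_z q)"
  by (simp add: ghom_def to_z_conv lext_lext ev_add ev_lext lext_fun_add add_ac)

lemma ghom_gx [simp]: "ghom p (gx i) = p i"
  by (simp add: ghom_def gx_def ev_def)

lemma ghom_gpoly [simp]: "ghom p (gpoly f) = gpoly (ev p f)"
  by (simp add: ghom_def gpoly_def)

lemma ghom_add: "ghom p (q + r) = ghom p q + ghom p r"
  by (simp add: ghom_def lext_add ev_add)

lemma ghom_gscale: "ghom p (gscale c q) = gscale c (ghom p q)"
  by (simp add: ghom_def gscale_conv lext_const_mult ev_mult ev_const distrib_left)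

lemma keys_lext_subset:
  assumes "\<And>i. i \<in> Poly_Mapping.keys u \<Longrightarrow> Poly_Mapping.keys (v i) \<subseteq> A"
  shows "Poly_Mapping.keys (lext v u) \<subseteq> A"
  unfolding lext_def using assms keys_sum[of _ "Poly_Mapping.keys u"] keys_const_mult by fast

text \<open>Each y_i is replaced by something of y-degree at least 1 and each z_i by something of
  z-degree at least 1, so neither bound can drop.\<close>

lemma yz_bounded_ev:
  assumes p: "\<And>i. i \<in> {1..d} \<Longrightarrow> p i \<in> G d" and f: "yz_bounded d k l f"
  shows "yz_bounded d k l (ev p f)"
  unfolding ev_def
proof (rule yz_bounded_lext, clarify)
  fix a b assume "(a, b) \<in> Poly_Mapping.keys f"
  from yz_bounded_monomial[OF f this]
  have ab: "Poly_Mapping.keys a \<subseteq> {1..d}" "Poly_Mapping.keys b \<subseteq> {1..d}" "k \<le> mdeg a" "l \<le> mdeg b"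
    by (auto simp: yz_bounded_YZ)
  have "yz_bounded d (mdeg a * 1) (mdeg a * 0) (mpow (\<lambda>i. to_y (p i)) a)"
    using p ab by (intro yz_bounded_mpow yz_bounded_to_y) auto
  moreover have "yz_bounded d (mdeg b * 0) (mdeg b * 1) (mpow (\<lambda>i. to_z (p i)) b)"
    using p ab by (intro yz_bounded_mpow yz_bounded_to_z) auto
  ultimately have "yz_bounded d (mdeg a * 1 + mdeg b * 0) (mdeg a * 0 + mdeg b * 1)
      (mpow (\<lambda>i. to_y (p i)) a * mpow (\<lambda>i. to_z (p i)) b)"
    by (rule yz_bounded_mult)
  then show "yz_bounded d k l (mpow (\<lambda>i. to_y (p i)) a * mpow (\<lambda>i. to_z (p i)) b)"
    using ab by (elim yz_bounded_mono) auto
qed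

lemma endomorphism_ghom:
  assumes "\<And>i. i \<in> {1..d} \<Longrightarrow> p i \<in> G d"
  shows "endomorphism (galg d) (ghom p)"
proof -
  have "ghom p q \<in> G d" if "q \<in> G d" for q
    unfolding in_G_iff
  proof
    show "Poly_Mapping.keys (fst (ghom p q)) \<subseteq> {1..d}"
      unfolding ghom_def fst_conv
    proof (rule keys_lext_subset)
      show "Poly_Mapping.keys (fst (p i)) \<subseteq> {1..d}" if "i \<in> Poly_Mapping.keys (fst q)" for i
        using that \<open>q \<in> G d\<close> assms[of i] unfolding in_G_iff by blast
    qed
    have "yz_bounded d 1 1 (lext (\<lambda>i. snd (p i)) (fst q))"
      using that assms by (intro yz_bounded_lext) (auto simp: in_G_iff)
    moreover have "yz_bounded d 1 1 (ev p (snd q))"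
      using that by (intro yz_bounded_ev assms) (auto simp: in_G_iff)
    ultimately show "yz_bounded d 1 1 (snd (ghom p q))"
      by (simp add: ghom_def yz_bounded_add)
  qed
  moreover have "ghom p (gmult q r) = gmult (ghom p q) (ghom p r)" for q r
    by (simp add: gmult_def to_y_ghom to_z_ghom ev_mult)
  ultimately show ?thesis
    by (simp add: endomorphism_def ghom_add ghom_gscale)
qed

section \<open>Subspaces, T-ideals and factor algebras\<close>

lemma subspaceD:
  assumes "subspace_of (galg d) S"
  shows "0 \<in> S" "p \<in> S \<Longrightarrow> p \<in> G d" "p \<in> S \<Longrightarrow> q \<in> S \<Longrightarrow> p + q \<in> S" "p \<in> S \<Longrightarrow> gscale c p \<in> S"
    "p \<in> S \<Longrightarrow> - p \<in> S" "p \<in> S \<Longrightarrow> q \<in> S \<Longrightarrow> p - q \<in> S"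
proof -
  show *: "0 \<in> S" "p \<in> S \<Longrightarrow> p \<in> G d" "p \<in> S \<Longrightarrow> q \<in> S \<Longrightarrow> p + q \<in> S" "p \<in> S \<Longrightarrow> gscale c p \<in> S" for p q c
    using assms by (auto simp: subspace_of_def)
  show **: "p \<in> S \<Longrightarrow> - p \<in> S" for p
    using *(4)[of p "-1"] by (simp add: gscale_minus_one)
  show "p \<in> S \<Longrightarrow> q \<in> S \<Longrightarrow> p - q \<in> S"
    using *(3)[of p "- q"] **[of q] by simp
qed

lemma subspace_gscaleD:
  assumes "subspace_of (galg d) S" "gscale c p \<in> S" "c \<noteq> 0"
  shows "p \<in> S"
  using subspaceD(4)[OF assms(1,2), of "inverse c"] assms(3) by (simp add: gscale_gscale)

lemma T_idealD:
  assumes "T_ideal (galg d) T"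
  shows "subspace_of (galg d) T" "p \<in> G d \<Longrightarrow> q \<in> T \<Longrightarrow> gmult p q \<in> T"
    "p \<in> G d \<Longrightarrow> q \<in> T \<Longrightarrow> gmult q p \<in> T" "endomorphism (galg d) \<phi> \<Longrightarrow> q \<in> T \<Longrightarrow> \<phi> q \<in> T"
  using assms by (auto simp: T_ideal_def ideal_of_def image_subset_iff)

lemma T_ideal_gen_least: "T_ideal A K \<Longrightarrow> S \<subseteq> K \<Longrightarrow> T_ideal_gen A S \<subseteq> K"
  by (auto simp: T_ideal_gen_def)

lemma T_ideal_gen_superset: "S \<subseteq> T_ideal_gen A S"
  by (auto simp: T_ideal_gen_def)

lemma T_ideal_T_ideal_gen:
  assumes "S \<subseteq> G d"
  shows "T_ideal (galg d) (T_ideal_gen (galg d) S)"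
proof -
  let ?T = "T_ideal_gen (galg d) S"
  \<comment> \<open>The carrier belongs to the family that is intersected; otherwise the
    intersection could leave it.\<close>
  have sub: "?T \<subseteq> G d" by (rule T_ideal_gen_least[OF T_ideal_G assms])
  have mem: "p \<in> ?T \<longleftrightarrow> (\<forall>K. T_ideal (galg d) K \<and> S \<subseteq> K \<longrightarrow> p \<in> K)" for p
    by (auto simp: T_ideal_gen_def)
  have "subspace_of (galg d) ?T"
    unfolding subspace_of_def using sub
    by (auto simp: mem intro: subspaceD[OF T_idealD(1)])
  moreover have "gmult p q \<in> ?T \<and> gmult q p \<in> ?T" if "p \<in> G d" "q \<in> ?T" for p q
    using that by (auto simp: mem intro: T_idealD)
  moreover have "\<phi> q \<in> ?T" if "endomorphism (galg d) \<phi>" "q \<in> ?T" for \<phi> q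
    using that by (auto simp: mem intro: T_idealD(4))
  ultimately show ?thesis by (auto simp: T_ideal_def ideal_of_def)
qed

text \<open>The operations of \<open>factor_alg\<close> are unions over all representatives; such a
  union collapses once every representative yields the same coset.\<close>

lemma UN_const_eq: "x \<in> P \<Longrightarrow> (\<And>x. x \<in> P \<Longrightarrow> f x = c) \<Longrightarrow> (\<Union>x\<in>P. f x) = c"
  by auto

lemma UN_UN_const_eq:
  "x \<in> P \<Longrightarrow> y \<in> R \<Longrightarrow> (\<And>x y. x \<in> P \<Longrightarrow> y \<in> R \<Longrightarrow> f x y = c) \<Longrightarrow> (\<Union>x\<in>P. \<Union>y\<in>R. f x y) = c"
  by (intro UN_const_eq) auto

section \<open>The factor algebra by a T-ideal, computed on representatives\<close>

locale factor =
  fixes d :: nat and J :: "'k::field gelem set"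
  assumes T_ideal_J: "T_ideal (galg d) J"
begin

abbreviation cs :: "'k gelem \<Rightarrow> 'k gelem set" where "cs \<equiv> coset (galg d) J"
abbreviation Q :: "('k, 'k gelem set) nalg" where "Q \<equiv> factor_alg (galg d) J"

lemmas J_subspace = T_idealD(1)[OF T_ideal_J]
lemmas J_simps = subspaceD[OF J_subspace]

lemma in_cs_iff: "x \<in> cs p \<longleftrightarrow> x - p \<in> J"
  by (auto simp: coset_def image_iff intro!: bexI[of _ "x - p"])

lemma cs_self: "p \<in> cs p"
  by (simp add: in_cs_iff J_simps)

lemma cs_eq_iff: "cs p = cs q \<longleftrightarrow> p - q \<in> J"
proof
  assume "cs p = cs q" then show "p - q \<in> J" using cs_self[of p] by (simp add: in_cs_iff)
next
  assume *: "p - q \<in> J"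
  have "x - p \<in> J \<longleftrightarrow> x - q \<in> J" for x
    using J_simps(3)[OF _ *, of "x - p"] J_simps(6)[OF _ *, of "x - q"] by auto
  then show "cs p = cs q" by (auto simp: in_cs_iff)
qed

lemma cs_eq_J_iff: "cs p = J \<longleftrightarrow> p \<in> J"
proof -
  have "cs 0 = J" by (auto simp: in_cs_iff)
  then show ?thesis using cs_eq_iff[of p 0] by simp
qed

lemma Q_zero: "zero Q = J" by (simp add: factor_alg_def)

lemma Q_carrier: "carrier Q = cs ` G d" by (simp add: factor_alg_def)

lemma Q_add: "add Q (cs p) (cs q) = cs (p + q)"
proof -
  have "cs (x + y) = cs (p + q)" if "x \<in> cs p" "y \<in> cs q" for x y
    using J_simps(3)[OF that[unfolded in_cs_iff]] by (simp add: cs_eq_iff algebra_simps)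
  from UN_UN_const_eq[OF cs_self cs_self this] show ?thesis
    by (simp add: factor_alg_def)
qed

lemma Q_scale: "scale Q c (cs p) = cs (gscale c p)"
proof -
  have "cs (gscale c x) = cs (gscale c p)" if "x \<in> cs p" for x
    using J_simps(4)[OF that[unfolded in_cs_iff], of c] by (simp add: cs_eq_iff gscale_diff)
  from UN_const_eq[OF cs_self this] show ?thesis
    by (simp add: factor_alg_def)
qed

text \<open>From x y - p q = (x - p) y + p (y - q). The ideal laws accept only multipliers from the
  carrier, hence the hypotheses that are absent from \<open>Q_add\<close> and
  \<open>Q_scale\<close>.\<close>

lemma Q_mult:
  assumes "p \<in> G d" "q \<in> G d"
  shows "mult Q (cs p) (cs q) = cs (gmult p q)"
proof -
  have "cs (gmult x y) = cs (gmult p q)" if "x \<in> cs p" "y \<in> cs q" for x y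
  proof -
    have "y = q + (y - q)" by simp
    then have "y \<in> G d" using that assms J_simps(2) add_in_G by (metis in_cs_iff)
    then have "gmult (x - p) y \<in> J" "gmult p (y - q) \<in> J"
      using that assms T_idealD[OF T_ideal_J] by (auto simp: in_cs_iff)
    then have "gmult (x - p) y + gmult p (y - q) \<in> J"
      by (rule J_simps(3))
    moreover have "gmult x y - gmult p q = gmult (x - p) y + gmult p (y - q)"
      using gmult_add(1)[of "x - p" p y] gmult_add(2)[of p "y - q" q] by (simp add: algebra_simps)
    ultimately show ?thesis by (simp add: cs_eq_iff)
  qed
  from UN_UN_const_eq[OF cs_self cs_self this] show ?thesis
    by (simp add: factor_alg_def)
qed

text \<open>Preimages along the coset map transport subspaces and T-ideals of the factor algebra
  back to G_d, where concrete substitutions are available.\<close>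

definition pre :: "'k gelem set set \<Rightarrow> 'k gelem set" where
  "pre K = {p \<in> G d. cs p \<in> K}"

lemma subspace_pre:
  assumes "subspace_of Q K"
  shows "subspace_of (galg d) (pre K)"
  unfolding subspace_of_def
proof (intro conjI ballI allI)
  have "cs 0 = J" by (simp add: cs_eq_J_iff J_simps)
  then show "zero (galg d) \<in> pre K"
    using assms by (simp add: pre_def zero_in_G subspace_of_def Q_zero)
  show "add (galg d) p q \<in> pre K" if "p \<in> pre K" "q \<in> pre K" for p q
    using that assms by (simp add: pre_def add_in_G subspace_of_def flip: Q_add)
  show "scale (galg d) c p \<in> pre K" if "p \<in> pre K" for c p
    using that assms by (simp add: pre_def gscale_in_G subspace_of_def flip: Q_scale)
qed (auto simp: pre_def)

lemma J_subset_pre: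
  assumes "subspace_of Q K"
  shows "J \<subseteq> pre K"
proof
  fix p assume "p \<in> J"
  then have "p \<in> G d" "cs p = J" by (simp_all add: J_simps cs_eq_J_iff)
  with assms show "p \<in> pre K" by (simp add: pre_def subspace_of_def Q_zero)
qed

text \<open>Since endomorphisms map \<open>J\<close> into itself, the coset of the image does not
  depend on the representative.\<close>

lemma induced_endomorphism:
  assumes "endomorphism (galg d) \<phi>"
  obtains \<psi> where "endomorphism Q \<psi>" "\<And>p. p \<in> G d \<Longrightarrow> \<psi> (cs p) = cs (\<phi> p)"
proof
  define \<psi> where "\<psi> P = (\<Union>p\<in>P. cs (\<phi> p))" for P
  show \<psi>: "\<psi> (cs p) = cs (\<phi> p)" if p: "p \<in> G d" for p
  proof -
    have "cs (\<phi> x) = cs (\<phi> p)" if "x \<in> cs p" for x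
    proof -
      from that have j: "x - p \<in> J" by (simp add: in_cs_iff)
      have "\<phi> x = \<phi> (x - p) + \<phi> p"
        using endomorphism_galgD(2)[OF assms J_simps(2)[OF j] p] by simp
      then show ?thesis
        using T_idealD(4)[OF T_ideal_J assms j] by (simp add: cs_eq_iff)
    qed
    from UN_const_eq[OF cs_self this] show ?thesis unfolding \<psi>_def .
  qed
  show "endomorphism Q \<psi>"
    unfolding endomorphism_def Q_carrier
    by (auto simp: \<psi> Q_add Q_scale Q_mult endomorphism_galgD[OF assms] add_in_G gscale_in_G gmult_in_G)
qed

lemma T_ideal_pre:
  assumes K: "T_ideal Q K"
  shows "T_ideal (galg d) (pre K)"
proof -
  have sub: "subspace_of Q K" using K by (simp add: T_ideal_def ideal_of_def)
  have "gmult p q \<in> pre K \<and> gmult q p \<in> pre K" if "p \<in> G d" "q \<in> pre K" for p q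
    using that K
    by (auto simp: pre_def gmult_in_G T_ideal_def ideal_of_def Q_carrier simp flip: Q_mult)
  moreover have "\<phi> q \<in> pre K" if \<phi>: "endomorphism (galg d) \<phi>" and q: "q \<in> pre K" for \<phi> q
  proof -
    obtain \<psi> where \<psi>: "endomorphism Q \<psi>" "\<And>p. p \<in> G d \<Longrightarrow> \<psi> (cs p) = cs (\<phi> p)"
      using induced_endomorphism[OF \<phi>] by blast
    have q': "q \<in> G d" "cs q \<in> K" using q by (simp_all add: pre_def)
    with K \<psi>(1) have "\<psi> (cs q) \<in> K" unfolding T_ideal_def by blast
    with q'(1) \<psi>(2) endomorphism_galgD(1)[OF \<phi>] show ?thesis by (simp add: pre_def)
  qed
  ultimately show ?thesis
    using subspace_pre[OF sub] by (auto simp: T_ideal_def ideal_of_def)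
qed

lemma subspace_image:
  assumes "subspace_of (galg d) S"
  shows "subspace_of Q (cs ` S)"
proof -
  have "J \<in> cs ` S" using subspaceD(1)[OF assms] cs_eq_J_iff[of 0] by (auto simp: J_simps)
  then show ?thesis
    using assms
    by (auto simp: subspace_of_def Q_carrier Q_zero Q_add Q_scale)
qed

lemma ideal_image:
  assumes "ideal_of (galg d) S"
  shows "ideal_of Q (cs ` S)"
proof -
  have sub: "subspace_of (galg d) S" using assms by (simp add: ideal_of_def)
  with subspace_image assms show ?thesis
    by (auto simp: ideal_of_def Q_carrier Q_mult subspaceD[OF sub])
qed

end

section \<open>Polynomials of degree at least two in the \<open>y\<^sub>i\<close>\<close>

definition W :: "nat \<Rightarrow> 'k::field gelem set" where
  "W d = {p \<in> G d. fst p = 0 \<and> yz_bounded d 2 1 (snd p)}"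

lemma gpoly_in_W_iff: "gpoly f \<in> W d \<longleftrightarrow> yz_bounded d 2 1 f"
  using yz_bounded_mono[of d 2 1 f 1 1] by (auto simp: W_def gpoly_in_G_iff) (auto simp: gpoly_def)

lemma in_W_E:
  assumes "p \<in> W d"
  obtains f where "p = gpoly f" "yz_bounded d 2 1 f"
  using assms by (auto simp: W_def gpoly_def prod_eq_iff)

lemma ideal_W: "ideal_of (galg d) (W d)"
proof -
  have "gmult p q \<in> W d" "gmult q p \<in> W d" if p: "p \<in> G d" and q: "q \<in> W d" for p q :: "'a gelem"
  proof -
    from q obtain f where f: "q = gpoly f" "yz_bounded d 2 1 f" by (rule in_W_E)
    from yz_bounded_mult[OF yz_bounded_to_y[OF p] f(2)] show "gmult p q \<in> W d"
      by (auto simp: f(1) gmult_def gpoly_in_W_iff elim: yz_bounded_mono)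
    from yz_bounded_mult[OF f(2) yz_bounded_to_z[OF p]] show "gmult q p \<in> W d"
      by (auto simp: f(1) gmult_def gpoly_in_W_iff elim: yz_bounded_mono)
  qed
  moreover have "gscale c p \<in> W d" if "p \<in> W d" for c and p :: "'a gelem"
    using that gscale_in_G[of p d c] by (simp add: W_def) (simp add: gscale_conv yz_bounded_const_mult)
  moreover have "p + q \<in> W d" if "p \<in> W d" "q \<in> W d" for p q :: "'a gelem"
    using that by (simp add: W_def add_in_G yz_bounded_add)
  moreover have "(0 :: 'a gelem) \<in> W d" "W d \<subseteq> (G d :: 'a gelem set)"
    by (auto simp: W_def zero_in_G)
  ultimately show ?thesis
    by (simp add: ideal_of_def subspace_of_def)
qed

lemma gmult_gmult_in_W:
  assumes "p \<in> G d" "q \<in> G d" "r \<in> G d"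
  shows "gmult p (gmult q r) \<in> W d"
  using yz_bounded_mult[OF yz_bounded_to_y yz_bounded_mult[OF yz_bounded_to_y yz_bounded_to_z], of p d q r] assms
  by (simp add: gmult_def gpoly_in_W_iff numeral_2_eq_2)

text \<open>
  Monomials of degree at least two in the \<open>y\<^sub>i\<close> are products of the form \<open>p (q r)\<close>; this
  makes \<open>W\<close>, and its image in any factor algebra, invariant under endomorphisms.
\<close>

lemma W_subset_subspaceI:
  fixes S :: "'k::field gelem set"
  assumes S: "subspace_of (galg d) S"
    and mem: "\<And>p q r. p \<in> G d \<Longrightarrow> q \<in> G d \<Longrightarrow> r \<in> G d \<Longrightarrow> gmult p (gmult q r) \<in> S"
  shows "W d \<subseteq> S"
proof
  fix w :: "'k gelem" assume "w \<in> W d"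
  then obtain f where f: "w = gpoly f" "yz_bounded d 2 1 f" by (rule in_W_E)
  have "gpoly f \<in> S"
  proof (rule gpoly_in_subspaceI[OF S])
    fix a b assume "(a, b) \<in> Poly_Mapping.keys f"
    from yz_bounded_monomial[OF f(2) this]
    have ab: "Poly_Mapping.keys a \<subseteq> {1..d}" "Poly_Mapping.keys b \<subseteq> {1..d}" "2 \<le> mdeg a" "1 \<le> mdeg b"
      by (auto simp: yz_bounded_YZ)
    from ab(3) have "1 \<le> mdeg a" by simp
    then obtain i a' where a: "a = Poly_Mapping.single i 1 + a'" "i \<in> Poly_Mapping.keys a"
      "Poly_Mapping.keys a' \<subseteq> Poly_Mapping.keys a" "mdeg a = Suc (mdeg a')"
      by (rule mdeg_pos_splitE)
    have "Poly_Mapping.keys a' \<subseteq> {1..d}" "1 \<le> mdeg a'" using a ab by auto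
    from YZ_is_product[OF this(1) ab(2) this(2) ab(4)] obtain r s n m
      where rs: "gpoly (YZ a' b :: 'k yzpoly) = gmult r s" "r \<in> gcomp d n" "s \<in> gcomp d m"
      by metis
    have "gpoly (YZ a b :: 'k yzpoly) = gmult (gx i) (gpoly (YZ a' b))"
      by (subst a(1)) (simp add: gmult_def yv_YZ)
    also have "\<dots> \<in> S"
      unfolding rs(1) using rs gcomp_subset a ab by (intro mem gx_in_G) auto
    finally show "gpoly (YZ a b :: 'k yzpoly) \<in> S" .
  qed
  with f show "w \<in> S" by simp
qed

lemma T_ideal_W: "T_ideal (galg d) (W d)"
proof -
  have "\<phi> w \<in> W d" if \<phi>: "endomorphism (galg d) \<phi>" and "w \<in> W d" for \<phi> :: "'a gelem \<Rightarrow> 'a gelem" and w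
  proof -
    have "W d \<subseteq> {p \<in> G d. \<phi> p \<in> W d}"
      using ideal_W
      by (intro W_subset_subspaceI subspace_vimage[OF \<phi>])
        (auto simp: ideal_of_def gmult_in_G endomorphism_galgD[OF \<phi>] gmult_gmult_in_W)
    with that show ?thesis by auto
  qed
  then show ?thesis using ideal_W by (auto simp: T_ideal_def)
qed

context factor begin

text \<open>An arbitrary endomorphism of the factor algebra is not lifted. It sends the cosets of p,
  q, r to cosets of some p', q', r', and p' (q' r') lies in \<open>W\<close> for every choice of
  these.\<close>

lemma T_ideal_image_W: "T_ideal Q (cs ` W d)"
proof -
  have "\<psi> (cs w) \<in> cs ` W d" if \<psi>: "endomorphism Q \<psi>" and "w \<in> W d" for \<psi> w
  proof -
    have sub: "subspace_of (galg d) (W d :: 'k gelem set)" using ideal_W by (auto simp: ideal_of_def)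
    have \<psi>c: "P \<in> carrier Q \<Longrightarrow> \<psi> P \<in> carrier Q" for P using \<psi> by (auto simp: endomorphism_def)
    have \<psi>a: "\<psi> (cs (p + q)) = add Q (\<psi> (cs p)) (\<psi> (cs q))" if "p \<in> G d" "q \<in> G d" for p q
      using \<psi> that by (auto simp: endomorphism_def Q_carrier simp flip: Q_add)
    have \<psi>s: "\<psi> (cs (gscale c p)) = scale Q c (\<psi> (cs p))" if "p \<in> G d" for c p
      using \<psi> that by (auto simp: endomorphism_def Q_carrier simp flip: Q_scale)
    have \<psi>m: "\<psi> (cs (gmult p q)) = mult Q (\<psi> (cs p)) (\<psi> (cs q))" if "p \<in> G d" "q \<in> G d" for p q
      using \<psi> that by (auto simp: endomorphism_def Q_carrier simp flip: Q_mult)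
    let ?S = "{p \<in> G d. \<psi> (cs p) \<in> cs ` W d}"
    have im: "subspace_of Q (cs ` W d)" by (rule subspace_image[OF sub])
    obtain p where p: "p \<in> G d" "\<psi> (cs 0) = cs p"
      using \<psi>c[of "cs 0"] zero_in_G unfolding Q_carrier by blast
    \<comment> \<open>Preservation of zero is obtained from compatibility with scaling by 0.\<close>
    have "\<psi> (cs 0) = scale Q 0 (\<psi> (cs 0))"
      using \<psi>s[of 0 0] by (simp add: zero_in_G)
    also have "\<dots> = cs 0"
      unfolding p Q_scale by (simp add: gscale_conv zero_prod_def)
    finally have z: "\<psi> (cs 0) = cs 0" .
    have "W d \<subseteq> ?S"
    proof (rule W_subset_subspaceI)
      show "subspace_of (galg d) ?S"
        using im z subspaceD(1)[OF sub]
        by (auto simp: subspace_of_def zero_in_G add_in_G gscale_in_G \<psi>a \<psi>s)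
      fix p q r :: "'k gelem" assume pqr: "p \<in> G d" "q \<in> G d" "r \<in> G d"
      then obtain p' q' r' where *: "p' \<in> G d" "q' \<in> G d" "r' \<in> G d"
        "\<psi> (cs p) = cs p'" "\<psi> (cs q) = cs q'" "\<psi> (cs r) = cs r'"
        using \<psi>c[of "cs p"] \<psi>c[of "cs q"] \<psi>c[of "cs r"] unfolding Q_carrier by blast
      with pqr have "\<psi> (cs (gmult p (gmult q r))) = cs (gmult p' (gmult q' r'))"
        by (simp add: \<psi>m gmult_in_G Q_mult)
      with * pqr show "gmult p (gmult q r) \<in> ?S"
        by (auto simp: gmult_in_G intro!: imageI gmult_gmult_in_W)
    qed
    with that show ?thesis by auto
  qed
  then show ?thesis using ideal_image[OF ideal_W] by (auto simp: T_ideal_def)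
qed

end

section \<open>Extraction of coefficients\<close>

lemma vandermonde_subspace:
  fixes S :: "'k::field_char_0 gelem set"
  assumes S: "subspace_of (galg d) S"
    and "\<And>t. gpoly (\<Sum>k\<le>N. const (t ^ k) * c k) \<in> S" "k \<le> N"
  shows "gpoly (c k) \<in> S"
  using assms(2,3)
proof (induction N arbitrary: c k)
  case 0
  from 0(1)[of 1] 0(2) show ?case by simp
next
  case (Suc N)
  \<comment> \<open>Subtracting \<open>2\<^sup>N\<^sup>+\<^sup>1\<close> times the value at \<open>t\<close> from the value at \<open>2 t\<close> removes the top term.\<close>
  have low: "gpoly (c k) \<in> S" if "k \<le> N" for k
  proof -
    have "gpoly (\<Sum>k\<le>N. const (t ^ k) * (const (2 ^ k - 2 ^ Suc N) * c k)) \<in> S" for t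
    proof -
      let ?F = "\<lambda>t. \<Sum>k\<le>Suc N. const (t ^ k) * c k"
      have "(\<Sum>k\<le>N. const (t ^ k) * (const (2 ^ k - 2 ^ Suc N) * c k)) =
          (\<Sum>k\<le>Suc N. const (t ^ k) * (const (2 ^ k - 2 ^ Suc N) * c k))"
        by simp
      also have "\<dots> = ?F (2 * t) - const (2 ^ Suc N) * ?F t"
        unfolding sum_distrib_left sum_subtractf[symmetric] power_mult_distrib const_mult single_diff
        by (intro sum.cong) (simp_all only: algebra_simps)
      finally show ?thesis
        using subspaceD(6)[OF S Suc.prems(1)[of "2 * t"] subspaceD(4)[OF S Suc.prems(1)[of t]]]
        by (simp only: gpoly_diff gscale_gpoly)
    qed
    from Suc.IH[OF this that] have "gscale (2 ^ k - 2 ^ Suc N) (gpoly (c k)) \<in> S"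
      by (simp only: gscale_gpoly)
    \<comment> \<open>Characteristic 0 keeps the powers of 2 distinct, so the factor acquired by
      each lower coefficient can be divided out.\<close>
    moreover have "(2 ^ k - 2 ^ Suc N :: 'k) \<noteq> 0"
    proof -
      have "(2 ^ k :: nat) \<noteq> 2 ^ Suc N" using that by (simp add: power_inject_exp del: power_Suc)
      then have "of_nat (2 ^ k) \<noteq> (of_nat (2 ^ Suc N) :: 'k)" by (simp only: of_nat_eq_iff not_False_eq_True)
      then show ?thesis by simp
    qed
    ultimately show ?thesis by (rule subspace_gscaleD[OF S])
  qed
  show ?case
  proof (cases "k \<le> N")
    case False
    with Suc.prems have k: "k = Suc N" by simp
    have "gpoly (\<Sum>k\<le>N. c k) \<in> S"
      unfolding gpoly_sum using low by (intro subspace_sum[OF S]) auto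
    from subspaceD(6)[OF S Suc.prems(1)[of 1] this] show ?thesis by (simp add: k gpoly_add)
  qed (rule low)
qed

text \<open>\<open>P\<close> is a polynomial in a formal t over the ring of yz-polynomials. Its
  values at scalars suffice to recover its coefficients by linear combinations.\<close>

lemma coeff_in_subspace:
  fixes S :: "'k::field_char_0 gelem set"
  assumes S: "subspace_of (galg d) S" and P: "\<And>t. gpoly (poly P (const t)) \<in> S"
  shows "gpoly (coeff P k) \<in> S"
proof (cases "k \<le> degree P")
  case True
  have pow: "const t ^ k = const (t ^ k)" for t :: 'k and k
    by (induction k) (simp_all add: mult_single)
  have "gpoly (\<Sum>k\<le>degree P. const (t ^ k) * coeff P k) \<in> S" for t
    using P[of t] by (simp add: poly_altdef pow mult.commute)
  from vandermonde_subspace[OF S this True] show ?thesis .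
next
  case False
  then show ?thesis by (simp add: coeff_eq_0 subspaceD(1)[OF S])
qed

lemma coeff_mult_low:
  fixes P R :: "'a::comm_ring_1 poly"
  shows "coeff (P * R) 0 = coeff P 0 * coeff R 0"
    "coeff (P * R) 1 = coeff P 0 * coeff R 1 + coeff P 1 * coeff R 0"
  by (simp_all add: coeff_mult atMost_Suc)

lemma coeff_power_low:
  fixes P :: "'a::comm_ring_1 poly"
  shows "coeff (P ^ n) 0 = coeff P 0 ^ n"
    "coeff (P ^ n) 1 = of_nat n * coeff P 0 ^ (n - 1) * coeff P 1"
proof -
  show *: "coeff (P ^ n) 0 = coeff P 0 ^ n" for n
    by (induction n) (simp_all add: coeff_mult_low)
  show "coeff (P ^ n) 1 = of_nat n * coeff P 0 ^ (n - 1) * coeff P 1"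
  proof (induction n)
    case (Suc n)
    then show ?case
      \<comment> \<open>The exponent \<open>n - 1\<close> is truncated at 0, where the factor
        \<open>of_nat n\<close> vanishes; this value has to be treated apart.\<close>
      by (cases n) (simp_all add: coeff_mult_low * algebra_simps del: One_nat_def)
  qed simp
qed

section \<open>Transvections\<close>

text \<open>As a matrix this is 1 + t E_ji. The coefficient of t in its action is the derivation x_i
  to x_j, which replaces one occurrence of index i by j.\<close>

definition transv :: "nat \<Rightarrow> nat \<Rightarrow> 'k::field \<Rightarrow> nat \<Rightarrow> 'k gelem" where
  "transv i j t k = (if k = i then gx i + gscale t (gx j) else gx k)"

lemma transv_in_G: "i \<in> {1..d} \<Longrightarrow> j \<in> {1..d} \<Longrightarrow> k \<in> {1..d} \<Longrightarrow> transv i j t k \<in> G d"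
  by (auto simp: transv_def intro!: add_in_G gscale_in_G gx_in_G)

lemma ev_YZ: "ev p (YZ a b) = mpow (\<lambda>i. to_y (p i)) a * mpow (\<lambda>i. to_z (p i)) b"
  by (simp add: ev_def YZ_def)

lemma mpow_zv: "mpow zv b = YZ 0 b"
proof (induction "mdeg b" arbitrary: b)
  case 0
  then have "b = 0" by (auto simp: mdeg_def in_keys_iff intro!: poly_mapping_eqI)
  then show ?case by (simp add: YZ_def flip: zero_prod_def)
next
  case (Suc n)
  then obtain i b' where b: "b = Poly_Mapping.single i 1 + b'" "mdeg b = Suc (mdeg b')"
    using mdeg_pos_splitE[of b] by (metis Suc_le_mono One_nat_def le0)
  then show ?case using Suc by (simp add: mpow_add zv_YZ)
qed

lemma ev_transv_YZ:
  assumes "i \<notin> Poly_Mapping.keys b"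
  shows "ev (transv i j t) (YZ 0 b) = YZ 0 b"
proof -
  have "mpow (\<lambda>k. to_z (transv i j t k)) b = mpow zv b"
    unfolding mpow_def using assms by (intro prod.cong) (auto simp: transv_def)
  then show ?thesis by (simp add: ev_YZ mpow_zv)
qed

lemma zv_power: "zv i ^ n = YZ 0 (Poly_Mapping.single i n)"
  using mpow_zv[of "Poly_Mapping.single i n"] by simp

lemma zv_power_splitE:
  obtains n b' where "(YZ 0 b :: 'k::field yzpoly) = zv i ^ n * YZ 0 b'" "i \<notin> Poly_Mapping.keys b'"
    "Poly_Mapping.keys b' \<subseteq> Poly_Mapping.keys b" "mdeg b = n + mdeg b'"
proof -
  let ?n = "Poly_Mapping.lookup b i"
  let ?b = "b - Poly_Mapping.single i ?n"
  have b: "b = Poly_Mapping.single i ?n + ?b"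
    by (intro poly_mapping_eqI) (auto simp: lookup_add lookup_minus lookup_single when_def)
  have "(YZ 0 b :: 'k yzpoly) = zv i ^ ?n * YZ 0 ?b"
    by (subst b) (simp add: zv_power YZ_mult)
  moreover have "mdeg b = ?n + mdeg ?b"
    by (subst b) (simp add: mdeg_add)
  moreover have "i \<notin> Poly_Mapping.keys ?b" "Poly_Mapping.keys ?b \<subseteq> Poly_Mapping.keys b"
    by (auto simp: in_keys_iff lookup_minus lookup_single when_def)
  ultimately show thesis using that by blast
qed

lemma gpoly_of_nat_multD:
  fixes S :: "'k::field_char_0 gelem set"
  assumes "subspace_of (galg d) S" "gpoly (of_nat n * f) \<in> S" "n \<noteq> 0"
  shows "gpoly f \<in> S"
  using subspace_gscaleD[of d S "of_nat n" "gpoly f"] assms by (simp add: gscale_gpoly)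

locale transv_closed =
  fixes d :: nat and S :: "'k::field_char_0 gelem set"
  assumes d: "2 \<le> d" and S: "subspace_of (galg d) S"
    and closed: "\<And>i j t f. i \<in> {1..d} \<Longrightarrow> j \<in> {1..d} \<Longrightarrow> i \<noteq> j \<Longrightarrow> gpoly f \<in> S \<Longrightarrow>
      gpoly (ev (transv i j t) f) \<in> S"
begin

lemma coeff_one_in_S:
  assumes "i \<in> {1..d}" "j \<in> {1..d}" "i \<noteq> j" "gpoly f \<in> S"
    and "\<And>t. ev (transv i j t) f = poly P (const t)"
  shows "gpoly (coeff P 1) \<in> S"
  using closed[OF assms(1-4)] assms(5) by (intro coeff_in_subspace[OF S]) auto

text \<open>Occurrences of z_1 are exchanged one at a time. The transvection x_1 to x_1 + t x_j
  fixes y_2 and every z_k with k different from 1, so the coefficient of t in its image of y_2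
  z_1^(r+1) Z^b' is (r+1) y_2 z_1^r z_j Z^b'.\<close>

lemma y2_all:
  assumes start: "gpoly (yv 2 * zv 1 ^ n) \<in> S"
    and b: "Poly_Mapping.keys b \<subseteq> {1..d}" "mdeg b = n"
  shows "gpoly (yv 2 * YZ 0 b) \<in> S"
proof -
  have main: "gpoly (yv 2 * zv 1 ^ r * YZ 0 b) \<in> S"
    if "Poly_Mapping.keys b \<subseteq> {1..d} - {1}" "r + mdeg b = n" for r b
    using that
  proof (induction "mdeg b" arbitrary: r b)
    case 0
    then have "b = 0" by (auto simp: mdeg_def in_keys_iff intro!: poly_mapping_eqI)
    with start 0 show ?case by (simp add: YZ_def flip: zero_prod_def)
  next
    case (Suc m)
    then have "1 \<le> mdeg b" by simp
    then obtain j b' where b: "b = Poly_Mapping.single j 1 + b'" "j \<in> Poly_Mapping.keys b"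
      "Poly_Mapping.keys b' \<subseteq> Poly_Mapping.keys b" "mdeg b = Suc (mdeg b')"
      by (rule mdeg_pos_splitE)
    have IH: "gpoly (yv 2 * zv 1 ^ Suc r * YZ 0 b') \<in> S"
      using Suc b by (intro Suc.hyps(1)) auto
    let ?P = "[:yv 2 :: 'k yzpoly:] * [:zv 1, zv j:] ^ Suc r * [:YZ 0 b':]"
    have nk: "1 \<notin> Poly_Mapping.keys b'" using b Suc.prems by auto
    have "ev (transv 1 j t) (yv 2 * zv 1 ^ Suc r * YZ 0 b') = poly ?P (const t)" for t
      unfolding ev_mult ev_power ev_transv_YZ[OF nk] poly_mult poly_power
      by (simp add: transv_def)
    moreover have "1 \<in> {1..d}" "j \<in> {1..d}" "1 \<noteq> j"
      using d b Suc.prems by auto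
    ultimately have "gpoly (coeff ?P 1) \<in> S"
      using coeff_one_in_S IH by blast
    also have "coeff ?P 1 = of_nat (Suc r) * (yv 2 * zv 1 ^ r * (zv j * YZ 0 b'))"
      by (simp only: coeff_mult_low coeff_power_low)
        (simp add: mult_ac del: of_nat_Suc)
    finally show ?case
      using gpoly_of_nat_multD[OF S] b(1) by (simp add: zv_YZ del: of_nat_Suc)
  qed
  obtain r b' where "(YZ 0 b :: 'k yzpoly) = zv 1 ^ r * YZ 0 b'" "1 \<notin> Poly_Mapping.keys b'"
    "Poly_Mapping.keys b' \<subseteq> Poly_Mapping.keys b" "mdeg b = r + mdeg b'"
    by (rule zv_power_splitE)
  with main[of b' r] b show ?thesis by (auto simp: mult.assoc)
qed

text \<open>Now x_2 is moved to x_j. With z_2^r split off from Z^b, the coefficient of t is y_j Z^b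
  plus r times a monomial that still begins with y_2; the latter is known from \<open>y2_all\<close>
  and is subtracted.\<close>

lemma y_all:
  assumes start: "gpoly (yv 2 * zv 1 ^ n) \<in> S"
    and b: "Poly_Mapping.keys b \<subseteq> {1..d}" "mdeg b = n" and j: "j \<in> {1..d}"
  shows "gpoly (yv j * YZ 0 b) \<in> S"
proof (cases "j = 2")
  case True
  with y2_all[OF start b] show ?thesis by simp
next
  case False
  obtain r b' where b': "(YZ 0 b :: 'k yzpoly) = zv 2 ^ r * YZ 0 b'" "2 \<notin> Poly_Mapping.keys b'"
    "Poly_Mapping.keys b' \<subseteq> Poly_Mapping.keys b" "mdeg b = r + mdeg b'"
    by (rule zv_power_splitE)
  let ?P = "[:yv 2, yv j :: 'k yzpoly:] * [:zv 2, zv j:] ^ r * [:YZ 0 b':]"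
  have "ev (transv 2 j t) (yv 2 * zv 2 ^ r * YZ 0 b') = poly ?P (const t)" for t
    unfolding ev_mult ev_power ev_transv_YZ[OF b'(2)] poly_mult poly_power by (simp add: transv_def)
  moreover have "gpoly (yv 2 * zv 2 ^ r * YZ 0 b') \<in> S"
    using y2_all[OF start b] b'(1) by (simp add: mult.assoc)
  moreover have "2 \<in> {1..d}" using d by auto
  ultimately have 1: "gpoly (coeff ?P 1) \<in> S"
    using coeff_one_in_S[of 2 j _ ?P] j False by blast
  have eq: "coeff ?P 1 = yv j * YZ 0 b + of_nat r * (yv 2 * (zv 2 ^ (r - 1) * zv j * YZ 0 b'))"
    unfolding coeff_mult_low coeff_power_low b'(1) by (simp add: algebra_simps)
  have 2: "gpoly (of_nat r * (yv 2 * (zv 2 ^ (r - 1) * zv j * YZ 0 b'))) \<in> S"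
  proof (cases r)
    case 0
    then show ?thesis by (simp add: subspaceD(1)[OF S])
  next
    case (Suc r')
    define c where "c = Poly_Mapping.single 2 r' + (Poly_Mapping.single j 1 + b')"
    have "zv 2 ^ (r - 1) * zv j * YZ 0 b' = (YZ 0 c :: 'k yzpoly)"
      by (simp add: Suc c_def mult.assoc zv_YZ) (simp add: zv_power YZ_mult)
    moreover have "Poly_Mapping.keys c \<subseteq> {2} \<union> ({j} \<union> Poly_Mapping.keys b')"
      unfolding c_def by (intro order_trans[OF keys_add] Un_mono) auto
    then have "Poly_Mapping.keys c \<subseteq> {1..d}" using b b' j d by force
    moreover have "mdeg c = n" using b b' Suc by (simp add: c_def mdeg_add)
    ultimately have "gpoly (yv 2 * (zv 2 ^ (r - 1) * zv j * YZ 0 b')) \<in> S"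
      using y2_all[OF start] by simp
    from subspaceD(4)[OF S this, of "of_nat r"] show ?thesis by (simp add: gscale_gpoly)
  qed
  from subspaceD(6)[OF S 1 2] show ?thesis unfolding eq gpoly_add by simp
qed

text \<open>Monomials of y-degree 1 come from \<open>y_all\<close>; all others lie in
  \<open>W\<close>.\<close>

lemma gcomp_subset_S:
  assumes n: "1 \<le> n" and start: "gpoly (yv 2 * zv 1 ^ n) \<in> S" and W: "W d \<inter> gcomp d (Suc n) \<subseteq> S"
  shows "gcomp d (Suc n) \<subseteq> S"
proof
  fix p :: "'k gelem" assume p: "p \<in> gcomp d (Suc n)"
  with n have eq: "p = gpoly (snd p)" by (simp add: in_gcomp_iff gpoly_def prod_eq_iff)
  have "gpoly (snd p) \<in> S"
  proof (rule gpoly_in_subspaceI[OF S])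
    fix a b assume ab: "(a, b) \<in> Poly_Mapping.keys (snd p)"
    with p have bd: "yz_bounded d 1 1 (YZ a b :: 'k yzpoly)" and deg: "mdeg a + mdeg b = Suc n"
      using yz_bounded_monomial[of d 1 1 "snd p" a b] by (auto simp: in_gcomp_iff in_G_iff homog_def)
    show "gpoly (YZ a b :: 'k yzpoly) \<in> S"
    proof (cases "mdeg a = 1")
      case True
      then have "1 \<le> mdeg a" by simp
      then obtain i a' where a: "a = Poly_Mapping.single i 1 + a'" "i \<in> Poly_Mapping.keys a"
        "mdeg a = Suc (mdeg a')"
        by (rule mdeg_pos_splitE)
      then have "a' = 0" using True by (auto simp: mdeg_def in_keys_iff intro!: poly_mapping_eqI)
      then have "(YZ a b :: 'k yzpoly) = yv i * YZ 0 b" using a by (simp add: yv_YZ)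
      moreover have "Poly_Mapping.keys b \<subseteq> {1..d}" "i \<in> {1..d}" "mdeg b = n"
        using bd a(2) True deg by (auto simp: yz_bounded_YZ)
      ultimately show ?thesis
        using y_all[OF start] by simp
    next
      case False
      with bd have "yz_bounded d 2 1 (YZ a b :: 'k yzpoly)" by (auto simp: yz_bounded_YZ)
      then have "gpoly (YZ a b :: 'k yzpoly) \<in> W d \<inter> gcomp d (Suc n)"
        using bd deg by (simp add: gpoly_in_W_iff gpoly_in_gcomp_iff homog_YZ)
      with W show ?thesis by blast
    qed
  qed
  with eq show "p \<in> S" by simp
qed

end

text \<open>The factor is returned as \<open>to_y p\<close> with \<open>p\<close> in the carrier, so
  that relations stated for arbitrary elements of G_d apply to monomials.\<close>

lemma YZ_split_y:
  fixes a b :: "nat \<Rightarrow>\<^sub>0 nat"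
  assumes "yz_bounded d (Suc m) k (YZ a b :: 'k::field yzpoly)"
  obtains p a' where "p \<in> G d" "(YZ a b :: 'k yzpoly) = to_y p * YZ a' b"
    "yz_bounded d m k (YZ a' b :: 'k yzpoly)"
proof -
  from assms have ab: "Poly_Mapping.keys a \<subseteq> {1..d}" "Poly_Mapping.keys b \<subseteq> {1..d}" "Suc m \<le> mdeg a" "k \<le> mdeg b"
    by (auto simp: yz_bounded_YZ)
  then have "1 \<le> mdeg a" by simp
  then obtain i a' where a: "a = Poly_Mapping.single i 1 + a'" "i \<in> Poly_Mapping.keys a"
    "Poly_Mapping.keys a' \<subseteq> Poly_Mapping.keys a" "mdeg a = Suc (mdeg a')"
    by (rule mdeg_pos_splitE)
  show thesis
  proof (rule that)
    show "gx i \<in> G d" using a(2) ab by (intro gx_in_G) auto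
    show "(YZ a b :: 'k yzpoly) = to_y (gx i) * YZ a' b" by (subst a(1)) (simp add: yv_YZ)
    show "yz_bounded d m k (YZ a' b :: 'k yzpoly)" using a ab by (auto simp: yz_bounded_YZ)
  qed
qed

lemma YZ_split_z:
  fixes a b :: "nat \<Rightarrow>\<^sub>0 nat"
  assumes "yz_bounded d m (Suc k) (YZ a b :: 'k::field yzpoly)"
  obtains p b' where "p \<in> G d" "(YZ a b :: 'k yzpoly) = YZ a b' * to_z p"
    "yz_bounded d m k (YZ a b' :: 'k yzpoly)"
proof -
  from assms have ab: "Poly_Mapping.keys a \<subseteq> {1..d}" "Poly_Mapping.keys b \<subseteq> {1..d}" "m \<le> mdeg a" "Suc k \<le> mdeg b"
    by (auto simp: yz_bounded_YZ)
  then have "1 \<le> mdeg b" by simp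
  then obtain i b' where b: "b = Poly_Mapping.single i 1 + b'" "i \<in> Poly_Mapping.keys b"
    "Poly_Mapping.keys b' \<subseteq> Poly_Mapping.keys b" "mdeg b = Suc (mdeg b')"
    by (rule mdeg_pos_splitE)
  show thesis
  proof (rule that)
    show "gx i \<in> G d" using b(2) ab by (intro gx_in_G) auto
    show "(YZ a b :: 'k yzpoly) = YZ a b' * to_z (gx i)"
      by (subst b(1)) (simp add: mult.commute[of "YZ a b'"] zv_YZ)
    show "yz_bounded d m k (YZ a b' :: 'k yzpoly)" using b ab by (auto simp: yz_bounded_YZ)
  qed
qed

lemma YZ_split_yz:
  fixes a b :: "nat \<Rightarrow>\<^sub>0 nat"
  assumes "yz_bounded d 1 1 (YZ a b :: 'k::field yzpoly)"
  obtains r s where "r \<in> G d" "s \<in> G d" "(YZ a b :: 'k yzpoly) = to_y r * to_z s"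
proof -
  from assms have "Poly_Mapping.keys a \<subseteq> {1..d}" "Poly_Mapping.keys b \<subseteq> {1..d}" "1 \<le> mdeg a" "1 \<le> mdeg b"
    by (auto simp: yz_bounded_YZ)
  then obtain r s n m where "gpoly (YZ a b :: 'k::field yzpoly) = gmult r s" "r \<in> gcomp d n" "s \<in> gcomp d m"
    by (rule YZ_is_product)
  moreover from this have "r \<in> G d" "s \<in> G d" using gcomp_subset by blast+
  ultimately show thesis using that[of r s] by (simp add: gmult_def gpoly_def)
qed

lemma gpoly_bounded_in_subspaceI:
  fixes f :: "'k::field yzpoly"
  assumes "subspace_of (galg d) S" "yz_bounded d m k f"
    and "\<And>a b. yz_bounded d m k (YZ a b :: 'k yzpoly) \<Longrightarrow> gpoly (YZ a b) \<in> S"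
  shows "gpoly f \<in> S"
proof (rule gpoly_in_subspaceI[OF assms(1)])
  show "gpoly (YZ a b) \<in> S" if "(a, b) \<in> Poly_Mapping.keys f" for a b
    using assms(3) yz_bounded_monomial[OF assms(2) that] .
qed

lemma T_ideal_subst:
  assumes "T_ideal (galg d) T" "gpoly f \<in> T" "\<And>i. i \<in> {1..d} \<Longrightarrow> p i \<in> G d"
  shows "gpoly (ev p f) \<in> T"
  using T_idealD(4)[OF assms(1) endomorphism_ghom[OF assms(3)] assms(2)] by simp

lemma T_ideal_mult:
  assumes "T_ideal (galg d) T" "p \<in> G d" "gpoly f \<in> T"
  shows "gpoly (to_y p * f) \<in> T" "gpoly (f * to_z p) \<in> T"
  using T_idealD(2,3)[OF assms] by (simp_all add: gmult_def)

lemma subspace_gpolyD: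
  fixes f g :: "'k::field yzpoly"
  assumes "subspace_of (galg d) S"
  shows "gpoly f \<in> S \<Longrightarrow> gpoly g \<in> S \<Longrightarrow> gpoly (f + g) \<in> S"
    "gpoly f \<in> S \<Longrightarrow> gpoly g \<in> S \<Longrightarrow> gpoly (f - g) \<in> S"
    "gpoly f \<in> S \<Longrightarrow> gpoly (const c * f) \<in> S"
    "gpoly f \<in> S \<Longrightarrow> gpoly (- f) \<in> S"
    "gpoly (const c * f) \<in> S \<Longrightarrow> c \<noteq> 0 \<Longrightarrow> gpoly f \<in> S"
  using subspaceD[OF assms] subspace_gscaleD[OF assms, of c "gpoly f"]
  by (simp_all add: gpoly_add gpoly_diff gpoly_uminus flip: gscale_gpoly)

section \<open>The T-ideal generated by \<open>x (x x)\<close>\<close>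

text \<open>\<open>J\<close> is any T-ideal between the one generated by y_1^2 z_1 and
  \<open>W\<close>; the nonzero scalar of the defining identity has been divided out.\<close>

locale cubic = factor d J for d :: nat and J :: "'k::field_char_0 gelem set" +
  assumes d2: "2 \<le> d" and gen: "gpoly (yv 1 ^ 2 * zv 1) \<in> J" and J_W: "J \<subseteq> W d"
begin

lemmas J_poly = subspace_gpolyD[OF J_subspace]
lemmas J_mult = T_ideal_mult[OF T_ideal_J]

lemma cube_in_J:
  assumes "a \<in> G d"
  shows "gpoly (to_y a ^ 2 * to_z a) \<in> J"
  using T_ideal_subst[OF T_ideal_J gen, of "\<lambda>_. a"] assms by (simp add: ev_simps)

lemma polarised_in_J:
  assumes "a \<in> G d" "b \<in> G d" "c \<in> G d"
  shows "gpoly (to_y a * to_y b * to_z c + to_y a * to_y c * to_z b + to_y b * to_y c * to_z a) \<in> J"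
    (is "gpoly ?s \<in> J")
proof -
  let ?f = "\<lambda>p :: 'k gelem. to_y p ^ 2 * to_z p"
  have f: "gpoly (?f p) \<in> J" if "p \<in> G d" for p using that by (rule cube_in_J)
  \<comment> \<open>Inclusion-exclusion extracts the multilinear part of the cube; the square of
    \<open>to_y\<close> makes each term occur twice.\<close>
  have "gpoly (?f (a + b + c) - ?f (a + b) - ?f (a + c) - ?f (b + c) + ?f a + ?f b + ?f c) \<in> J"
    by (intro J_poly(1,2) f add_in_G assms)
  also have "?f (a + b + c) - ?f (a + b) - ?f (a + c) - ?f (b + c) + ?f a + ?f b + ?f c = const 2 * ?s"
    by (simp add: algebra_simps power2_eq_square)
  finally show ?thesis using J_poly(5) by (metis zero_neq_numeral)
qed

text \<open>Write s(a,b,c) for the polarised cube. In Ya s(b,c,m) + Yb s(a,c,m) + Yc s(a,b,m) the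
  wanted monomial occurs three times, and the remaining terms form 2 Ym s(a,b,c).\<close>

lemma yyyz_in_J:
  assumes "a \<in> G d" "b \<in> G d" "c \<in> G d" "m \<in> G d"
  shows "gpoly (to_y a * to_y b * to_y c * to_z m) \<in> J"
proof -
  let ?s = "\<lambda>a b c :: 'k gelem. to_y a * to_y b * to_z c + to_y a * to_y c * to_z b + to_y b * to_y c * to_z a"
  have "gpoly (to_y a * ?s b c m + to_y b * ?s a c m + to_y c * ?s a b m - const 2 * (to_y m * ?s a b c)) \<in> J"
    by (intro J_poly(1-3) J_mult(1) polarised_in_J assms)
  also have "to_y a * ?s b c m + to_y b * ?s a c m + to_y c * ?s a b m - const 2 * (to_y m * ?s a b c) =
      const 3 * (to_y a * to_y b * to_y c * to_z m)"
    by (simp add: algebra_simps)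
  finally show ?thesis using J_poly(5) by (metis zero_neq_numeral)
qed

lemma yyzz_in_J:
  assumes "a \<in> G d" "b \<in> G d" "c \<in> G d" "e \<in> G d"
  shows "gpoly (to_y a * to_y b * to_z c * to_z e) \<in> J"
proof -
  \<comment> \<open>Replacing the third argument of the polarised relation by the product
    \<open>gmult c e\<close> creates one term with three y-factors, already in \<open>J\<close>. The
    other two say that, in the presence of Yc Ze, exchanging a and b in Ya Zb changes the sign
    modulo \<open>J\<close>.\<close>
  have swap: "gpoly (to_y a * to_z b * to_y c * to_z e + to_y b * to_z a * to_y c * to_z e) \<in> J"
    if "a \<in> G d" "b \<in> G d" "c \<in> G d" "e \<in> G d" for a b c e
  proof -
    let ?q = "gmult c e"
    have "gpoly (to_y a * to_y b * to_z ?q + to_y a * to_y ?q * to_z b + to_y b * to_y ?q * to_z a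
        - to_y a * to_y b * to_y c * to_z e) \<in> J"
      by (intro J_poly(2) polarised_in_J yyyz_in_J gmult_in_G that)
    also have "to_y a * to_y b * to_z ?q + to_y a * to_y ?q * to_z b + to_y b * to_y ?q * to_z a
        - to_y a * to_y b * to_y c * to_z e = to_y a * to_z b * to_y c * to_z e + to_y b * to_z a * to_y c * to_z e"
      by (simp add: gmult_def algebra_simps)
    finally show ?thesis .
  qed
  let ?s = "to_y a * to_y b * to_z c + to_y a * to_y c * to_z b + to_y b * to_y c * to_z a"
  \<comment> \<open>The two instances of \<open>swap\<close> together contain the wanted monomial
    twice and the other two terms of \<open>?s * to_z e\<close> once each.\<close>
  have "gpoly ((to_y b * to_z c * to_y a * to_z e + to_y c * to_z b * to_y a * to_z e) +
      (to_y a * to_z c * to_y b * to_z e + to_y c * to_z a * to_y b * to_z e) - ?s * to_z e) \<in> J"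
    by (intro J_poly(1,2) J_mult(2) polarised_in_J swap assms)
  also have "(to_y b * to_z c * to_y a * to_z e + to_y c * to_z b * to_y a * to_z e) +
      (to_y a * to_z c * to_y b * to_z e + to_y c * to_z a * to_y b * to_z e) - ?s * to_z e =
      to_y a * to_y b * to_z c * to_z e"
    by (simp add: algebra_simps)
  finally show ?thesis .
qed

lemma bounded_31_in_J:
  assumes "yz_bounded d 3 1 f"
  shows "gpoly f \<in> J"
proof (rule gpoly_bounded_in_subspaceI[OF J_subspace assms])
  fix a b assume "yz_bounded d 3 1 (YZ a b :: 'k yzpoly)"
  then have "yz_bounded d (Suc (Suc 1)) 1 (YZ a b :: 'k yzpoly)" by (simp add: numeral_3_eq_3)
  then obtain p a' where p: "p \<in> G d" "(YZ a b :: 'k yzpoly) = to_y p * YZ a' b"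
    "yz_bounded d (Suc 1) 1 (YZ a' b :: 'k yzpoly)"
    by (rule YZ_split_y)
  from p(3) obtain q a'' where q: "q \<in> G d" "(YZ a' b :: 'k yzpoly) = to_y q * YZ a'' b"
    "yz_bounded d 1 1 (YZ a'' b :: 'k yzpoly)"
    by (rule YZ_split_y)
  from q(3) obtain r s where r: "r \<in> G d" "s \<in> G d" "(YZ a'' b :: 'k yzpoly) = to_y r * to_z s"
    by (rule YZ_split_yz)
  from yyyz_in_J[OF p(1) q(1) r(1,2)] show "gpoly (YZ a b :: 'k yzpoly) \<in> J"
    by (simp add: p(2) q(2) r(3) mult.assoc)
qed

lemma bounded_22_in_J:
  assumes "yz_bounded d 2 2 f"
  shows "gpoly f \<in> J"
proof (rule gpoly_bounded_in_subspaceI[OF J_subspace assms])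
  fix a b assume "yz_bounded d 2 2 (YZ a b :: 'k yzpoly)"
  then have "yz_bounded d (Suc 1) (Suc 1) (YZ a b :: 'k yzpoly)" by (simp add: numeral_2_eq_2)
  then obtain p a' where p: "p \<in> G d" "(YZ a b :: 'k yzpoly) = to_y p * YZ a' b"
    "yz_bounded d 1 (Suc 1) (YZ a' b :: 'k yzpoly)"
    by (rule YZ_split_y)
  from p(3) obtain q b' where q: "q \<in> G d" "(YZ a' b :: 'k yzpoly) = YZ a' b' * to_z q"
    "yz_bounded d 1 1 (YZ a' b' :: 'k yzpoly)"
    by (rule YZ_split_z)
  from q(3) obtain r s where r: "r \<in> G d" "s \<in> G d" "(YZ a' b' :: 'k yzpoly) = to_y r * to_z s"
    by (rule YZ_split_yz)
  from yyzz_in_J[OF p(1) r(1,2) q(1)] show "gpoly (YZ a b :: 'k yzpoly) \<in> J"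
    by (simp add: p(2) q(2) r(3) mult.assoc)
qed

text \<open>With y-degree at least 2 and z-degree at least 1, total degree 4 forces one of the
  bidegree bounds (3,1) and (2,2).\<close>

lemma W_gcomp_in_J:
  assumes "4 \<le> n"
  shows "W d \<inter> gcomp d n \<subseteq> J"
proof
  fix p :: "'k gelem" assume p: "p \<in> W d \<inter> gcomp d n"
  then obtain f where f: "p = gpoly f" "yz_bounded d 2 1 f" using in_W_E by blast
  with p have h: "homog n f" by (simp add: gpoly_in_gcomp_iff)
  have "gpoly f \<in> J"
  proof (rule gpoly_in_subspaceI[OF J_subspace])
    fix a b assume ab: "(a, b) \<in> Poly_Mapping.keys f"
    have "yz_bounded d 2 1 (YZ a b :: 'k yzpoly)" by (rule yz_bounded_monomial[OF f(2) ab])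
    moreover have "4 \<le> mdeg a + mdeg b" using h ab assms by (auto simp: homog_def)
    ultimately have "yz_bounded d 3 1 (YZ a b :: 'k yzpoly) \<or> yz_bounded d 2 2 (YZ a b :: 'k yzpoly)"
      by (auto simp: yz_bounded_YZ)
    then show "gpoly (YZ a b :: 'k yzpoly) \<in> J" using bounded_31_in_J bounded_22_in_J by blast
  qed
  with f show "p \<in> J" by simp
qed

section \<open>From T-ideals of G_d to consequences in the factor algebra\<close>

lemma transv_closed_T_ideal:
  assumes "T_ideal (galg d) T"
  shows "transv_closed d T"
proof
  show "gpoly (ev (transv i j t) f) \<in> T" if "i \<in> {1..d}" "j \<in> {1..d}" "gpoly f \<in> T" for i j t f
    using T_ideal_subst[OF assms that(3)] transv_in_G[OF that(1,2)] by blast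
qed (use d2 T_idealD[OF assms] in auto)

lemma gcomp_subset_T_ideal:
  assumes "T_ideal (galg d) T" "J \<subseteq> T" "3 \<le> n" "gpoly (yv 2 * zv 1 ^ n) \<in> T"
  shows "gcomp d (n + 1) \<subseteq> T"
proof -
  interpret transv_closed d T by (rule transv_closed_T_ideal[OF assms(1)])
  show ?thesis using gcomp_subset_S[of n] assms W_gcomp_in_J[of "Suc n"] by auto
qed

abbreviation consequences :: "nat \<Rightarrow> 'k gelem \<Rightarrow> 'k gelem set set" where
  "consequences m f \<equiv> T_ideal_gen Q {cs f} \<inter> cs ` gcomp d m"

text \<open>Each T-ideal of the factor algebra containing the coset of \<open>f\<close> is pulled
  back by \<open>pre\<close>; the result contains \<open>f\<close> and \<open>J\<close>.\<close>

lemma consequences_eq_all: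
  assumes "f \<in> G d"
    and "\<And>T. T_ideal (galg d) T \<Longrightarrow> J \<subseteq> T \<Longrightarrow> f \<in> T \<Longrightarrow> gcomp d m \<subseteq> T"
  shows "consequences m f = cs ` gcomp d m"
proof -
  have "cs p \<in> K" if p: "p \<in> gcomp d m" and K: "T_ideal Q K" "cs f \<in> K" for p K
  proof -
    have "subspace_of Q K" using K by (simp add: T_ideal_def ideal_of_def)
    from assms(2)[OF T_ideal_pre[OF K(1)] J_subset_pre[OF this]] have "gcomp d m \<subseteq> pre K"
      using assms(1) K(2) by (simp add: pre_def)
    with p show ?thesis by (auto simp: pre_def)
  qed
  then show ?thesis by (auto simp: T_ideal_gen_def)
qed

lemma y2z1_notin_W: "gpoly (yv 2 * zv 1 ^ n :: 'k yzpoly) \<notin> W d"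
proof -
  have eq: "yv 2 * zv 1 ^ n = (YZ (Poly_Mapping.single 2 1) (Poly_Mapping.single 1 n) :: 'k yzpoly)"
    by (simp add: yv_def zv_power YZ_mult)
  show ?thesis unfolding gpoly_in_W_iff eq yz_bounded_YZ by simp
qed

text \<open>The last hypothesis is used twice. Applied to T = \<open>W\<close> it shows that
  \<open>f\<close> is nonzero in the factor algebra, since otherwise \<open>W\<close> would contain
  y_2 z_1^n; applied to general T it yields the whole next component.\<close>

lemma identity_consequences:
  assumes "f \<in> gcomp d n" "3 \<le> n"
    and "\<And>T. T_ideal (galg d) T \<Longrightarrow> J \<subseteq> T \<Longrightarrow> f \<in> T \<Longrightarrow> gpoly (yv 2 * zv 1 ^ n) \<in> T"
  shows "f \<notin> J" "consequences (n + 1) f = cs ` gcomp d (n + 1)"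
proof -
  show "f \<notin> J" using assms(3)[OF T_ideal_W J_W] J_W y2z1_notin_W by blast
  show "consequences (n + 1) f = cs ` gcomp d (n + 1)"
    using assms gcomp_subset by (intro consequences_eq_all gcomp_subset_T_ideal) auto
qed

section \<open>Substituting y_2 z_1 into the given identities\<close>

lemma var_bounded:
  "yz_bounded d 1 0 (yv 1 :: 'k yzpoly)" "yz_bounded d 0 1 (zv 1 :: 'k yzpoly)"
  "yz_bounded d 1 0 (yv 2 :: 'k yzpoly)" "yz_bounded d 0 1 (zv 2 :: 'k yzpoly)"
  using d2 yz_bounded_var[of 1 d] yz_bounded_var[of 2 d] by simp_all

lemma yz_bounded_multI:
  "yz_bounded d i j f \<Longrightarrow> yz_bounded d k l g \<Longrightarrow> m \<le> i + k \<Longrightarrow> n \<le> j + l \<Longrightarrow> yz_bounded d m n (f * g)"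
  by (rule yz_bounded_mono[OF yz_bounded_mult])

text \<open>The binomial expansion to first order in q, with the z-degree of the cofactor recorded:
  it makes the error term of the next lemma fall under \<open>bounded_22_in_J\<close>.\<close>

lemma add_power_split:
  assumes "yz_bounded d 0 1 z" "yz_bounded d 0 1 q"
  shows "\<exists>h. yz_bounded d 0 m h \<and> (z + q) ^ Suc m = z ^ Suc m + q * h"
proof (induction m)
  case 0
  show ?case by (intro exI[of _ 1]) (simp add: yz_bounded_one)
next
  case (Suc m)
  then obtain h where h: "yz_bounded d 0 m h" "(z + q) ^ Suc m = z ^ Suc m + q * h" by blast
  have "(z + q) ^ Suc (Suc m) = z ^ Suc (Suc m) + q * (z ^ Suc m + (z + q) * h)"
    by (subst power_Suc, subst h(2)) (simp add: algebra_simps)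
  moreover have "yz_bounded d 0 (Suc m) (z ^ Suc m + (z + q) * h)"
  proof (rule yz_bounded_add)
    show "yz_bounded d 0 (Suc m) (z ^ Suc m)" using yz_bounded_power[OF assms(1), of "Suc m"] by simp
    show "yz_bounded d 0 (Suc m) ((z + q) * h)"
      using yz_bounded_mult[OF yz_bounded_add[OF assms] h(1)] by simp
  qed
  ultimately show ?case by blast
qed

text \<open>After substituting x_1 + q with q = y_2 z_1, every occurrence of q in a z-slot raises
  the y-degree to at least 2 and dies in \<open>J\<close>. Only q in the y-slot survives: q
  z_1^(n-1) = y_2 z_1^n.\<close>

lemma y1z1_implies:
  assumes T: "T_ideal (galg d) T" "J \<subseteq> T" and n: "3 \<le> n" and f: "gpoly (yv 1 * zv 1 ^ (n - 1)) \<in> T"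
  shows "gpoly (yv 2 * zv 1 ^ n) \<in> T"
proof -
  define q :: "'k yzpoly" where "q = yv 2 * zv 1"
  have q: "yz_bounded d 1 1 q" unfolding q_def by (rule yz_bounded_multI[OF var_bounded(3,2)]) auto
  define p where "p i = (if i = 1 then gx 1 + gpoly q else gx i)" for i
  have "p i \<in> G d" if "i \<in> {1..d}" for i
    using that q by (auto simp: p_def gpoly_in_G_iff intro!: add_in_G gx_in_G)
  with T_ideal_subst[OF T(1) f, of p]
  have "gpoly (ev p (yv 1 * zv 1 ^ (n - 1))) \<in> T" by blast
  also have "ev p (yv 1 * zv 1 ^ (n - 1)) = (yv 1 + q) * (zv 1 + q) ^ (n - 1)"
    by (simp add: ev_simps p_def)
  finally have 1: "gpoly ((yv 1 + q) * (zv 1 + q) ^ (n - 1)) \<in> T" .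
  from n obtain m where m: "n - 1 = Suc m" "1 \<le> m" by (cases "n - 1") auto
  from add_power_split[OF var_bounded(2) yz_bounded_mono[OF q], of m]
  obtain h where h: "yz_bounded d 0 m h" "(zv 1 + q) ^ Suc m = zv 1 ^ Suc m + q * h" by auto
  have "yz_bounded d 2 2 ((yv 1 + q) * (q * h))"
  proof (rule yz_bounded_multI)
    show "yz_bounded d 1 0 (yv 1 + q)" by (intro yz_bounded_add var_bounded yz_bounded_mono[OF q]) auto
    show "yz_bounded d 1 (1 + m) (q * h)" using yz_bounded_mult[OF q h(1)] by simp
  qed (use m in auto)
  then have 2: "gpoly ((yv 1 + q) * (q * h)) \<in> T" using bounded_22_in_J T(2) by blast
  have "gpoly ((yv 1 + q) * (zv 1 + q) ^ (n - 1) - yv 1 * zv 1 ^ (n - 1) - (yv 1 + q) * (q * h)) \<in> T"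
    by (intro subspace_gpolyD(2)[OF T_idealD(1)[OF T(1)]] 1 2 f)
  also have "(yv 1 + q) * (zv 1 + q) ^ (n - 1) - yv 1 * zv 1 ^ (n - 1) - (yv 1 + q) * (q * h) = q * zv 1 ^ (n - 1)"
    unfolding m h(2) by (simp add: algebra_simps)
  also have "\<dots> = yv 2 * zv 1 ^ n"
    using n by (cases n) (simp_all add: q_def mult.assoc)
  finally show ?thesis .
qed

abbreviation D12 :: "'k yzpoly" where "D12 \<equiv> yv 1 * zv 2 - yv 2 * zv 1"

text \<open>Substituting q = y_2 z_1 for x_2 turns \<open>D12\<close> into y_1 q - q z_1. Of the
  resulting terms only -\<beta>2 q z_1^(n-1) has y-degree 1; the others lie in \<open>J\<close>. The
  \<beta>1 term matters for n = 3, and larger n are served by \<beta>1 = 0.\<close>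

lemma D12_implies:
  assumes T: "T_ideal (galg d) T" "J \<subseteq> T" and n: "3 \<le> n" and \<beta>: "\<beta>2 \<noteq> 0"
    and f: "gpoly (const \<beta>1 * (yv 1 * D12) + const \<beta>2 * (D12 * zv 1 ^ (n - 2))) \<in> T"
  shows "gpoly (yv 2 * zv 1 ^ n) \<in> T"
proof -
  define q :: "'k yzpoly" where "q = yv 2 * zv 1"
  have q: "yz_bounded d 1 1 q" unfolding q_def by (rule yz_bounded_multI[OF var_bounded(3,2)]) auto
  define p where "p i = (if i = 2 then gpoly q else gx i)" for i
  have "p i \<in> G d" if "i \<in> {1..d}" for i
    using that q by (auto simp: p_def gpoly_in_G_iff intro!: gx_in_G)
  with T_ideal_subst[OF T(1) f, of p]
  have 1: "gpoly (const \<beta>1 * (yv 1 * (yv 1 * q - q * zv 1)) + const \<beta>2 * ((yv 1 * q - q * zv 1) * zv 1 ^ (n - 2))) \<in> T"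
    by (simp add: ev_simps p_def)
  have "yz_bounded d 3 1 (yv 1 * (yv 1 * q))"
    by (intro yz_bounded_multI[OF var_bounded(1) yz_bounded_mult[OF var_bounded(1) q]]) auto
  then have 2: "gpoly (yv 1 * (yv 1 * q)) \<in> T" using bounded_31_in_J T(2) by blast
  have "yz_bounded d 2 2 (yv 1 * (q * zv 1))"
    by (intro yz_bounded_multI[OF var_bounded(1) yz_bounded_mult[OF q var_bounded(2)]]) auto
  then have 3: "gpoly (yv 1 * (q * zv 1)) \<in> T" using bounded_22_in_J T(2) by blast
  have "yz_bounded d (1 + 1) (0 + 1) (yv 1 * q)" by (rule yz_bounded_mult[OF var_bounded(1) q])
  from yz_bounded_mult[OF this yz_bounded_power[OF var_bounded(2), of "n - 2"]]
  have "yz_bounded d 2 2 (yv 1 * q * zv 1 ^ (n - 2))" by (rule yz_bounded_mono) (use n in auto)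
  then have 4: "gpoly (yv 1 * q * zv 1 ^ (n - 2)) \<in> T" using bounded_22_in_J T(2) by blast
  have "gpoly (const \<beta>1 * (yv 1 * (yv 1 * q)) - const \<beta>1 * (yv 1 * (q * zv 1)) + const \<beta>2 * (yv 1 * q * zv 1 ^ (n - 2))
      - (const \<beta>1 * (yv 1 * (yv 1 * q - q * zv 1)) + const \<beta>2 * ((yv 1 * q - q * zv 1) * zv 1 ^ (n - 2)))) \<in> T"
    by (intro subspace_gpolyD(1-3)[OF T_idealD(1)[OF T(1)]] 1 2 3 4)
  also have "const \<beta>1 * (yv 1 * (yv 1 * q)) - const \<beta>1 * (yv 1 * (q * zv 1)) + const \<beta>2 * (yv 1 * q * zv 1 ^ (n - 2))
      - (const \<beta>1 * (yv 1 * (yv 1 * q - q * zv 1)) + const \<beta>2 * ((yv 1 * q - q * zv 1) * zv 1 ^ (n - 2)))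
      = const \<beta>2 * (q * (zv 1 * zv 1 ^ (n - 2)))"
    by (simp add: algebra_simps)
  also have "q * (zv 1 * zv 1 ^ (n - 2)) = yv 2 * zv 1 ^ n"
  proof -
    from n obtain k where "n = Suc (Suc k)" by (cases n; cases "n - 1") auto
    then show ?thesis by (simp add: q_def mult_ac)
  qed
  finally show ?thesis using subspace_gpolyD(5)[OF T_idealD(1)[OF T(1)]] \<beta> by blast
qed

lemma D12_bounded: "yz_bounded d 1 1 D12" "homog 2 D12"
proof -
  show "yz_bounded d 1 1 D12"
    by (intro yz_bounded_diff yz_bounded_multI[OF var_bounded(1,4)] yz_bounded_multI[OF var_bounded(3,2)]) auto
  have "homog (1 + 1) D12" by (intro homog_diff homog_mult homog_var)
  then show "homog 2 D12" by (simp add: numeral_2_eq_2)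
qed

text \<open>The generator lies in \<open>W\<close>, so all its consequences lie in the image of
  \<open>W\<close>, and \<open>W\<close> vanishes modulo \<open>J\<close> in degree 4.\<close>

lemma consequences_D12_y1: "consequences 4 (gpoly (yv 1 * D12)) = {J}"
proof
  have W: "gpoly (yv 1 * D12) \<in> W d"
    unfolding gpoly_in_W_iff by (intro yz_bounded_multI[OF var_bounded(1) D12_bounded(1)]) auto
  have sub: "T_ideal_gen Q {cs (gpoly (yv 1 * D12))} \<subseteq> cs ` W d"
    using W by (intro T_ideal_gen_least T_ideal_image_W) auto
  show "consequences 4 (gpoly (yv 1 * D12)) \<subseteq> {J}"
  proof
    fix P assume "P \<in> consequences 4 (gpoly (yv 1 * D12))"
    with sub obtain p w where p: "p \<in> gcomp d 4" "P = cs p" and w: "w \<in> W d" "P = cs w" by blast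
    then have "p - w \<in> J" using cs_eq_iff by blast
    then have "(p - w) + w \<in> W d"
      using J_W w subspaceD(3)[OF T_idealD(1)[OF T_ideal_W]] by blast
    with p W_gcomp_in_J[of 4] have "p \<in> J" by auto
    then show "P \<in> {J}" using p cs_eq_J_iff by simp
  qed
  have "J \<in> T_ideal_gen Q {cs (gpoly (yv 1 * D12))}"
    by (auto simp: T_ideal_gen_def T_ideal_def ideal_of_def subspace_of_def Q_zero)
  moreover have "J = cs 0" using cs_eq_J_iff[of 0] by (simp add: J_simps)
  ultimately show "{J} \<subseteq> consequences 4 (gpoly (yv 1 * D12))"
    using subspaceD(1)[OF subspace_gcomp, of d 4] by blast
qed

end

section \<open>Identities of degree one and two\<close>

text \<open>Used after setting variables to 0, when only the listed monomials can
  contribute.\<close>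

lemma lext_restrict:
  assumes "finite M" "\<And>m. m \<in> Poly_Mapping.keys u \<Longrightarrow> m \<notin> M \<Longrightarrow> v m = 0"
  shows "lext v u = (\<Sum>m\<in>M. const (Poly_Mapping.lookup u m) * v m)"
proof -
  have "lext v u = (\<Sum>m\<in>Poly_Mapping.keys u \<union> M. const (Poly_Mapping.lookup u m) * v m)"
    by (rule lext_superset) (use assms in auto)
  also have "\<dots> = (\<Sum>m\<in>M. const (Poly_Mapping.lookup u m) * v m)"
    by (rule sum.mono_neutral_right) (use assms in auto)
  finally show ?thesis .
qed

lemma mdeg_eq_1E:
  assumes "mdeg a = 1"
  obtains i where "a = Poly_Mapping.single i 1" "i \<in> Poly_Mapping.keys a"
proof -
  from assms have "1 \<le> mdeg a" by simp
  then obtain i a' where a: "a = Poly_Mapping.single i 1 + a'" "i \<in> Poly_Mapping.keys a" "mdeg a = Suc (mdeg a')"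
    by (rule mdeg_pos_splitE)
  then have "a' = 0" using assms by (auto simp: mdeg_def in_keys_iff intro!: poly_mapping_eqI)
  with a that show thesis by simp
qed

context cubic begin

text \<open>If x_i has coefficient c different from 0, sending x_i to p / c and every other variable
  to 0 turns \<open>f\<close> into the arbitrary element p.\<close>

lemma degree_one_implies:
  fixes T :: "'k gelem set"
  assumes T: "T_ideal (galg d) T" and f: "f \<in> gcomp d 1" "f \<noteq> 0" "f \<in> T"
  shows "G d \<subseteq> T"
proof
  fix p :: "'k gelem" assume p: "p \<in> G d"
  have snd: "snd f = 0" using gcomp_one_snd f by blast
  with f(2) obtain i where i: "Poly_Mapping.lookup (fst f) i \<noteq> 0"
    by (metis prod_eq_iff fst_zero snd_zero poly_mapping_eqI lookup_zero)
  let ?c = "Poly_Mapping.lookup (fst f) i"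
  define v where "v k = (if k = i then gscale (inverse ?c) p else 0)" for k
  have "ghom v f \<in> T"
    using p by (intro T_idealD(4)[OF T endomorphism_ghom] f) (auto simp: v_def gscale_in_G zero_in_G)
  moreover have "ghom v f = gscale ?c (v i)"
    using lext_restrict[of "{i}" "fst f" "\<lambda>k. fst (v k)"] lext_restrict[of "{i}" "fst f" "\<lambda>k. snd (v k)"]
    by (simp add: ghom_def snd v_def gscale_conv ev_def)
  moreover have "gscale ?c (v i) = p" using i by (simp add: v_def gscale_gscale)
  ultimately show "p \<in> T" by simp
qed

lemma gcomp3_subset:
  fixes T :: "'k gelem set"
  assumes T: "T_ideal (galg d) T"
    and yyz: "\<And>a b c. a \<in> G d \<Longrightarrow> b \<in> G d \<Longrightarrow> c \<in> G d \<Longrightarrow> gpoly (to_y a * to_y b * to_z c) \<in> T"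
    and yzz: "\<And>a b c. a \<in> G d \<Longrightarrow> b \<in> G d \<Longrightarrow> c \<in> G d \<Longrightarrow> gpoly (to_y a * to_z b * to_z c) \<in> T"
  shows "gcomp d 3 \<subseteq> T"
proof
  fix p :: "'k gelem" assume p: "p \<in> gcomp d 3"
  then have eq: "p = gpoly (snd p)" by (simp add: in_gcomp_iff gpoly_def prod_eq_iff)
  have "gpoly (snd p) \<in> T"
  proof (rule gpoly_in_subspaceI[OF T_idealD(1)[OF T]])
    fix a b assume ab: "(a, b) \<in> Poly_Mapping.keys (snd p)"
    with p have "yz_bounded d 1 1 (YZ a b :: 'k yzpoly)" "mdeg a + mdeg b = 3"
      using yz_bounded_monomial[of d 1 1 "snd p" a b] by (auto simp: in_gcomp_iff in_G_iff homog_def)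
    then consider "yz_bounded d (Suc 1) 1 (YZ a b :: 'k yzpoly)" | "yz_bounded d 1 (Suc 1) (YZ a b :: 'k yzpoly)"
      unfolding yz_bounded_YZ by linarith
    then show "gpoly (YZ a b :: 'k yzpoly) \<in> T"
    proof cases
      case 1
      then obtain q a' where q: "q \<in> G d" "(YZ a b :: 'k yzpoly) = to_y q * YZ a' b"
        "yz_bounded d 1 1 (YZ a' b :: 'k yzpoly)" by (rule YZ_split_y)
      from q(3) obtain r s where r: "r \<in> G d" "s \<in> G d" "(YZ a' b :: 'k yzpoly) = to_y r * to_z s"
        by (rule YZ_split_yz)
      from yyz[OF q(1) r(1,2)] show ?thesis by (simp add: q(2) r(3) mult.assoc)
    next
      case 2
      then obtain q b' where q: "q \<in> G d" "(YZ a b :: 'k yzpoly) = YZ a b' * to_z q"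
        "yz_bounded d 1 1 (YZ a b' :: 'k yzpoly)" by (rule YZ_split_z)
      from q(3) obtain r s where r: "r \<in> G d" "s \<in> G d" "(YZ a b' :: 'k yzpoly) = to_y r * to_z s"
        by (rule YZ_split_yz)
      from yzz[OF r(1,2) q(1)] show ?thesis by (simp add: q(2) r(3))
    qed
  qed
  with eq show "p \<in> T" by simp
qed

text \<open>After linearisation, Ya Zb is skew modulo \<open>T\<close>. Three multiples of the skew
  relation combine to 2 Ya Yb Zc; a product in one argument then gives Ya Zb Zc.\<close>

lemma square_implies:
  fixes T :: "'k gelem set"
  assumes T: "T_ideal (galg d) T"
    and sq: "\<And>a. a \<in> G d \<Longrightarrow> gpoly (to_y a * to_z a) \<in> T"
  shows "gcomp d 3 \<subseteq> T"
proof -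
  note T_poly = subspace_gpolyD[OF T_idealD(1)[OF T]]
  have sym: "gpoly (to_y a * to_z b + to_y b * to_z a) \<in> T" if "a \<in> G d" "b \<in> G d" for a b
  proof -
    have "gpoly (to_y (a + b) * to_z (a + b) - to_y a * to_z a - to_y b * to_z b) \<in> T"
      by (intro T_poly(2) sq add_in_G that)
    then show ?thesis by (simp add: algebra_simps)
  qed
  have yyz: "gpoly (to_y a * to_y b * to_z c) \<in> T" if "a \<in> G d" "b \<in> G d" "c \<in> G d" for a b c
  proof -
    have "gpoly (to_y a * (to_y b * to_z c + to_y c * to_z b) + to_y b * (to_y a * to_z c + to_y c * to_z a)
        - to_y c * (to_y a * to_z b + to_y b * to_z a)) \<in> T"
      by (intro T_poly(1,2) T_ideal_mult(1)[OF T] sym that)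
    also have "to_y a * (to_y b * to_z c + to_y c * to_z b) + to_y b * (to_y a * to_z c + to_y c * to_z a)
        - to_y c * (to_y a * to_z b + to_y b * to_z a) = const 2 * (to_y a * to_y b * to_z c)"
      by (simp add: algebra_simps)
    finally show ?thesis using T_poly(5) by (metis zero_neq_numeral)
  qed
  have yzz: "gpoly (to_y a * to_z b * to_z c) \<in> T" if "a \<in> G d" "b \<in> G d" "c \<in> G d" for a b c
  proof -
    have "gpoly (to_y c * to_z (gmult a b) + to_y (gmult a b) * to_z c - to_y c * to_y a * to_z b) \<in> T"
      by (intro T_poly(2) sym yyz gmult_in_G that)
    then show ?thesis by (simp add: gmult_def algebra_simps)
  qed
  from gcomp3_subset[OF T yyz yzz] show ?thesis .
qed

text \<open>Modulo commutators the z-slot can be exchanged with any y-slot, so the three terms of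
  the polarised cube coincide and give 3 Ya Yb Zc.\<close>

lemma commutator_implies:
  assumes T: "T_ideal (galg d) T" "J \<subseteq> T"
    and comm: "\<And>a b. a \<in> G d \<Longrightarrow> b \<in> G d \<Longrightarrow> gpoly (to_y a * to_z b - to_y b * to_z a) \<in> T"
  shows "gcomp d 3 \<subseteq> T"
proof -
  note T_poly = subspace_gpolyD[OF T_idealD(1)[OF T(1)]]
  have yyz: "gpoly (to_y a * to_y b * to_z c) \<in> T" if "a \<in> G d" "b \<in> G d" "c \<in> G d" for a b c
  proof -
    let ?s = "to_y a * to_y b * to_z c + to_y a * to_y c * to_z b + to_y b * to_y c * to_z a"
    have s: "gpoly ?s \<in> T" using polarised_in_J[OF that] T(2) by blast
    have "gpoly (?s + to_y a * (to_y b * to_z c - to_y c * to_z b) + to_y b * (to_y a * to_z c - to_y c * to_z a)) \<in> T"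
      by (intro T_poly(1)[OF T_poly(1)[OF s]] T_ideal_mult(1)[OF T(1)] comm that)
    also have "?s + to_y a * (to_y b * to_z c - to_y c * to_z b) + to_y b * (to_y a * to_z c - to_y c * to_z a)
        = const 3 * (to_y a * to_y b * to_z c)"
      by (simp add: algebra_simps)
    finally show ?thesis using T_poly(5) by (metis zero_neq_numeral)
  qed
  have yzz: "gpoly (to_y a * to_z b * to_z c) \<in> T" if "a \<in> G d" "b \<in> G d" "c \<in> G d" for a b c
  proof -
    have "gpoly (to_y c * to_y a * to_z b - (to_y c * to_z (gmult a b) - to_y (gmult a b) * to_z c)) \<in> T"
      by (intro T_poly(2) comm yyz gmult_in_G that)
    then show ?thesis by (simp add: gmult_def algebra_simps)
  qed
  from gcomp3_subset[OF T(1) yyz yzz] show ?thesis .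
qed

text \<open>Keeping only x_i and x_j leaves a 2 by 2 coefficient matrix. A nonzero diagonal entry
  gives the square identity by b = 0; with zero diagonal and nonzero sum of the other entries, a = b
  gives it too; the remaining skew matrix gives the commutator.\<close>

lemma degree_two_implies:
  assumes T: "T_ideal (galg d) T" "J \<subseteq> T" and f: "f \<in> gcomp d 2" "f \<noteq> 0" "f \<in> T"
  shows "gcomp d 3 \<subseteq> T"
proof -
  note T_poly = subspace_gpolyD[OF T_idealD(1)[OF T(1)]]
  define g where "g = snd f"
  have fg: "f = gpoly g" using f(1) by (simp add: g_def in_gcomp_iff gpoly_def prod_eq_iff)
  let ?e = "\<lambda>i j. (Poly_Mapping.single i 1, Poly_Mapping.single j 1) :: (nat \<Rightarrow>\<^sub>0 nat) \<times> (nat \<Rightarrow>\<^sub>0 nat)"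
  let ?c = "\<lambda>i j. Poly_Mapping.lookup g (?e i j)"
  have keysE: "\<exists>i j. m = ?e i j \<and> i \<in> {1..d} \<and> j \<in> {1..d}" if "m \<in> Poly_Mapping.keys g" for m
  proof -
    obtain a b where m: "m = (a, b)" by (cases m)
    from f(1) fg have "yz_bounded d 1 1 g" "homog 2 g" by (simp_all add: gpoly_in_gcomp_iff)
    with that m have ab: "Poly_Mapping.keys a \<subseteq> {1..d}" "Poly_Mapping.keys b \<subseteq> {1..d}"
      "1 \<le> mdeg a" "1 \<le> mdeg b" "mdeg a + mdeg b = 2"
      unfolding yz_bounded_def homog_def by fast+
    then have "mdeg a = 1" "mdeg b = 1" by auto
    then show ?thesis using ab m by (elim mdeg_eq_1E) blast
  qed
  have key: "gpoly (const (?c i i) * (to_y a * to_z a) + const (?c i j) * (to_y a * to_z b) +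
      const (?c j i) * (to_y b * to_z a) + const (?c j j) * (to_y b * to_z b)) \<in> T"
    if "i \<noteq> j" "a \<in> G d" "b \<in> G d" for i j a b
  proof -
    define p where "p k = (if k = i then a else if k = j then b else 0)" for k
    have "\<And>k. p k \<in> G d" using that by (simp add: p_def zero_in_G)
    then have "gpoly (ev p g) \<in> T" using T_ideal_subst[OF T(1), of g p] f(3) fg by blast
    moreover have "ev p g = (\<Sum>m\<in>{?e i i, ?e i j, ?e j i, ?e j j}. const (Poly_Mapping.lookup g m) *
        (case m of (a, b) \<Rightarrow> mpow (\<lambda>i. to_y (p i)) a * mpow (\<lambda>i. to_z (p i)) b))"
      unfolding ev_def
    proof (rule lext_restrict)
      fix m assume m: "m \<in> Poly_Mapping.keys g" "m \<notin> {?e i i, ?e i j, ?e j i, ?e j j}"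
      from keysE[OF m(1)] obtain k l where kl: "m = ?e k l" by blast
      with m(2) have "p k = 0 \<or> p l = 0" by (auto simp: p_def)
      then show "(case m of (a, b) \<Rightarrow> mpow (\<lambda>i. to_y (p i)) a * mpow (\<lambda>i. to_z (p i)) b) = 0"
        by (auto simp: kl)
    qed simp
    \<comment> \<open>Distinctness makes the sum over the set of exponents have four separate
      terms.\<close>
    moreover have "?e i i \<noteq> ?e i j" "?e i i \<noteq> ?e j i" "?e i i \<noteq> ?e j j" "?e i j \<noteq> ?e j i" "?e i j \<noteq> ?e j j" "?e j i \<noteq> ?e j j"
      using \<open>i \<noteq> j\<close> by (auto dest!: arg_cong[where f = Poly_Mapping.keys])
    ultimately show ?thesis using \<open>i \<noteq> j\<close> by (simp add: p_def add.assoc)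
  qed
  have diag: "gcomp d 3 \<subseteq> T" if "?c i i \<noteq> 0" for i
  proof (rule square_implies[OF T(1)])
    fix a :: "'k gelem" assume "a \<in> G d"
    \<comment> \<open>\<open>Suc i\<close> is merely an index different from i; its variable is set
      to 0.\<close>
    from key[of i "Suc i" a 0, OF _ this zero_in_G] show "gpoly (to_y a * to_z a) \<in> T"
      using T_poly(5)[OF _ that] by simp
  qed
  from f(2) fg have "g \<noteq> 0" by auto
  then obtain m where m: "m \<in> Poly_Mapping.keys g" by (metis keys_eq_empty all_not_in_conv)
  from keysE[OF m] m obtain i j where ij: "?c i j \<noteq> 0" by (auto simp: in_keys_iff)
  show ?thesis
  proof (cases "?c i i = 0 \<and> ?c j j = 0")
    case False
    then show ?thesis using diag by blast
  next
    case True
    with ij have "i \<noteq> j" by auto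
    have k: "gpoly (const (?c i j) * (to_y a * to_z b) + const (?c j i) * (to_y b * to_z a)) \<in> T"
      if "a \<in> G d" "b \<in> G d" for a b
      using key[OF \<open>i \<noteq> j\<close> that] True by simp
    show ?thesis
    proof (cases "?c i j + ?c j i = 0")
      case False
      show ?thesis
      proof (rule square_implies[OF T(1)])
        fix a :: "'k gelem" assume "a \<in> G d"
        from k[OF this this] have "gpoly (const (?c i j + ?c j i) * (to_y a * to_z a)) \<in> T"
          by (simp add: single_add distrib_right)
        from T_poly(5)[OF this False] show "gpoly (to_y a * to_z a) \<in> T" .
      qed
    next
      case True
      then have c: "?c j i = - ?c i j" by (simp add: eq_neg_iff_add_eq_0 add.commute)
      show ?thesis
      proof (rule commutator_implies[OF T])
        fix a b :: "'k gelem" assume "a \<in> G d" "b \<in> G d"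
        from k[OF this] have "gpoly (const (?c i j) * (to_y a * to_z b - to_y b * to_z a)) \<in> T"
          unfolding c single_uminus by (simp add: right_diff_distrib)
        from T_poly(5)[OF this ij] show "gpoly (to_y a * to_z b - to_y b * to_z a) \<in> T" .
      qed
    qed
  qed
qed

end

section \<open>The action of the general linear group\<close>

lemma endomorphism_id: "endomorphism (galg d) (\<lambda>p. p)"
  by (simp add: endomorphism_def)

lemma endomorphism_comp:
  assumes "endomorphism (galg d) \<phi>" "endomorphism (galg d) \<psi>"
  shows "endomorphism (galg d) (\<lambda>p. \<phi> (\<psi> p))"
  using endomorphism_galgD[OF assms(1)] endomorphism_galgD[OF assms(2)]
  by (simp add: endomorphism_def)

lemma automorphism_transv:
  assumes ij: "i \<in> {1..d}" "j \<in> {1..d}" "i \<noteq> j"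
  shows "automorphism (galg d) (ghom (transv i j t))"
proof -
  have endo: "endomorphism (galg d) (ghom (transv i j t))" for t
    by (rule endomorphism_ghom) (rule transv_in_G[OF ij(1,2)])
  have inv: "ghom (transv i j (- t)) (ghom (transv i j t) p) = p" if "p \<in> G d" for t p
  proof (rule endomorphism_eq_on_G[OF endomorphism_comp[OF endo endo] endomorphism_id _ that])
    fix k assume "k \<in> {1..d}"
    show "ghom (transv i j (- t)) (ghom (transv i j t) (gx k)) = gx k"
      using ij(3)
      by (simp add: transv_def ghom_add ghom_gscale) (simp add: gscale_conv single_uminus prod_eq_iff)
  qed
  have "bij_betw (ghom (transv i j t)) (G d) (G d)"
    using inv[of _ t] inv[of _ "- t"] endomorphism_galgD(1)[OF endo]
    by (intro bij_betw_byWitness[where f' = "ghom (transv i j (- t))"]) auto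
  with endo show ?thesis by (simp add: automorphism_def)
qed

lemma transv_GL:
  fixes t :: "'k::field"
  assumes ij: "i \<in> {1..d}" "j \<in> {1..d}" "i \<noteq> j"
  shows "\<exists>g\<in>GL d. GL_acts_by d g (ghom (transv i j t))"
proof
  \<comment> \<open>The matrix 1 + t E_ji, whose column i is the image of x_i. As i and j differ,
    E_ji squares to 0 and the inverse is obtained from -t.\<close>
  define g :: "'k \<Rightarrow> nat \<Rightarrow> nat \<Rightarrow> 'k" where
    "g t a k = (if a = k then 1 else 0) + (if a = j then if k = i then t else 0 else 0)" for t a k
  have "(\<Sum>k=1..d. g t a k * g (- t) k b) = (if a = b then 1 else 0)"
    if "a \<in> {1..d}" "b \<in> {1..d}" for t a b
  proof -
    have "(\<Sum>k=1..d. g t a k * g (- t) k b) =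
        (\<Sum>k=1..d. (if k = a then g (- t) k b else 0) + (if k = i then if a = j then t * g (- t) k b else 0 else 0))"
      by (intro sum.cong) (auto simp: g_def[of t] distrib_right)
    also have "\<dots> = g (- t) a b + (if a = j then t * g (- t) i b else 0)"
      using that ij by (simp add: sum.distrib)
    also have "\<dots> = (if a = b then 1 else 0)" using ij by (auto simp: g_def)
    finally show ?thesis .
  qed
  from this[of _ _ t] this[of _ _ "- t"] show "g t \<in> GL d"
    unfolding GL_def by (auto intro!: exI[of _ "g (- t)"])
  have "ghom (transv i j t) (gx l) = (\<Sum>k=1..d. gscale (g t k l) (gx k))" if l: "l \<in> {1..d}" for l
  proof -
    have "(\<Sum>k=1..d. gscale (g t k l) (gx k)) =
        (\<Sum>k=1..d. (if k = l then gx k else 0) + (if k = j then if l = i then gscale t (gx k) else 0 else 0))"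
      by (intro sum.cong) (use ij(3) in \<open>auto simp: g_def gscale_zero_left\<close>)
    also have "\<dots> = gx l + (if l = i then gscale t (gx j) else 0)"
      using l ij by (simp add: sum.distrib)
    finally show ?thesis by (simp add: transv_def)
  qed
  with automorphism_transv[OF ij] show "GL_acts_by d (g t) (ghom (transv i j t))"
    by (simp add: GL_acts_by_def)
qed

context factor begin

text \<open>The inverse is an endomorphism as well, so it maps \<open>J\<close> into itself; thus
  the automorphism maps \<open>J\<close> onto \<open>J\<close> and cosets onto full cosets.\<close>

lemma automorphism_image_cs:
  assumes \<phi>: "automorphism (galg d) \<phi>" and p: "p \<in> G d"
  shows "\<phi> ` cs p = cs (\<phi> p)"
proof -
  have endo: "endomorphism (galg d) \<phi>" and bij: "bij_betw \<phi> (G d) (G d)"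
    using \<phi> by (simp_all add: automorphism_def)
  note \<phi>D = endomorphism_galgD[OF endo]
  define \<psi> where "\<psi> = inv_into (G d) \<phi>"
  have \<psi>G: "\<psi> q \<in> G d" and \<phi>\<psi>: "\<phi> (\<psi> q) = q" if "q \<in> G d" for q
    using bij that by (auto simp: \<psi>_def bij_betw_def inv_into_into f_inv_into_f)
  have \<psi>\<phi>: "\<psi> (\<phi> q) = q" if "q \<in> G d" for q
    using bij that by (auto simp: \<psi>_def bij_betw_def)
  have "endomorphism (galg d) \<psi>"
    unfolding endomorphism_def galg_simps
  proof (intro conjI ballI allI funcsetI)
    fix q r :: "'k gelem" and c :: 'k assume q: "q \<in> G d" and r: "r \<in> G d"
    show "\<psi> (q + r) = \<psi> q + \<psi> r"
      using \<psi>\<phi>[of "\<psi> q + \<psi> r"] q r by (simp add: \<phi>D \<psi>G \<phi>\<psi> add_in_G)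
    show "\<psi> (gmult q r) = gmult (\<psi> q) (\<psi> r)"
      using \<psi>\<phi>[of "gmult (\<psi> q) (\<psi> r)"] q r by (simp add: \<phi>D \<psi>G \<phi>\<psi> gmult_in_G)
  next
    fix q :: "'k gelem" and c :: 'k assume q: "q \<in> G d"
    show "\<psi> (gscale c q) = gscale c (\<psi> q)"
      using \<psi>\<phi>[of "gscale c (\<psi> q)"] q by (simp add: \<phi>D \<psi>G \<phi>\<psi> gscale_in_G)
  qed (rule \<psi>G)
  then have \<psi>J: "\<psi> q \<in> J" if "q \<in> J" for q using T_idealD(4)[OF T_ideal_J] that by blast
  show ?thesis
  proof
    show "\<phi> ` cs p \<subseteq> cs (\<phi> p)"
    proof (rule image_subsetI)
      fix x assume "x \<in> cs p"
      then have x: "x - p \<in> J" by (simp add: in_cs_iff)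
      have "\<phi> x = \<phi> (x - p) + \<phi> p" using \<phi>D(2)[OF J_simps(2)[OF x] p] by simp
      then show "\<phi> x \<in> cs (\<phi> p)"
        using T_idealD(4)[OF T_ideal_J endo x] by (simp add: in_cs_iff)
    qed
    show "cs (\<phi> p) \<subseteq> \<phi> ` cs p"
    proof
      fix x assume "x \<in> cs (\<phi> p)"
      then have x: "x - \<phi> p \<in> J" by (simp add: in_cs_iff)
      have "\<phi> (\<psi> (x - \<phi> p) + p) = x"
        using x p by (simp add: \<phi>D \<psi>G \<phi>\<psi> J_simps(2))
      moreover have "\<psi> (x - \<phi> p) + p \<in> cs p" using \<psi>J[OF x] by (simp add: in_cs_iff)
      ultimately show "x \<in> \<phi> ` cs p" by (metis imageI)
    qed
  qed
qed

end

section \<open>The variety with \<alpha> = (\<alpha>1, 0)\<close>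

lemma U_ideal_cubic:
  fixes \<alpha> :: "'k::field_char_0 \<times> 'k"
  assumes "d \<ge> 2" "snd \<alpha> = 0" "fst \<alpha> \<noteq> 0"
  shows "cubic d (U_ideal d \<alpha>)"
proof -
  let ?f = "gpoly (yv 1 ^ 2 * zv 1) :: 'k gelem"
  have U: "U_ideal d \<alpha> = T_ideal_gen (galg d) {gscale (fst \<alpha>) ?f}"
    by (simp add: U_ideal_def assms gscale_conv flip: zero_prod_def)
  have b: "yz_bounded d 1 0 (yv 1 :: 'k yzpoly)" "yz_bounded d 0 1 (zv 1 :: 'k yzpoly)"
    using assms(1) yz_bounded_var[of 1 d] by simp_all
  have W: "gscale (fst \<alpha>) ?f \<in> W d"
    using yz_bounded_mult[OF yz_bounded_power[OF b(1), of 2] b(2)]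
    by (simp add: gscale_gpoly gpoly_in_W_iff yz_bounded_const_mult)
  then have "{gscale (fst \<alpha>) ?f} \<subseteq> G d" by (simp add: W_def)
  from T_ideal_T_ideal_gen[OF this] have T: "T_ideal (galg d) (U_ideal d \<alpha>)" by (simp add: U)
  show ?thesis
  proof
    show "T_ideal (galg d) (U_ideal d \<alpha>)" by (rule T)
    show "gpoly (yv 1 ^ 2 * zv 1) \<in> U_ideal d \<alpha>"
      using subspace_gscaleD[OF T_idealD(1)[OF T] _ assms(3), of ?f] T_ideal_gen_superset[of _ "galg d"]
      by (auto simp: U)
    show "U_ideal d \<alpha> \<subseteq> W d" unfolding U using W by (intro T_ideal_gen_least T_ideal_W) auto
  qed (rule assms)
qed

text \<open>Linear substitutions preserve degrees, which bounds the submodule from above. From below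
  it suffices to find y_2 z_1^n in it, because monomials in \<open>W\<close> vanish from degree 4
  on.\<close>

lemma GL_gen_eq_U_comp:
  fixes \<alpha> :: "'k::field_char_0 \<times> 'k"
  assumes "d \<ge> 2" "snd \<alpha> = 0" "fst \<alpha> \<noteq> 0" and n: "3 \<le> n"
  shows "GL_gen d \<alpha> {U_img d \<alpha> (gpoly (yv 1 * zv 1 ^ n)),
      U_img d \<alpha> (gpoly ((yv 1 * zv 2 - yv 2 * zv 1) * zv 1 ^ (n - 1)))} = U_comp d \<alpha> (n + 1)"
    (is "GL_gen d \<alpha> ?L = _")
proof -
  interpret cubic d "U_ideal d \<alpha>" by (rule U_ideal_cubic[OF assms(1-3)])
  have h: "homog n (zv 1 ^ n :: 'k yzpoly)" "homog (n - 1) (zv 1 ^ (n - 1) :: 'k yzpoly)"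
    using homog_power[OF homog_var(2), of n 1] homog_power[OF homog_var(2), of "n - 1" 1] by simp_all
  have L1: "gpoly (yv 1 * zv 1 ^ n :: 'k yzpoly) \<in> gcomp d (n + 1)"
    unfolding gpoly_in_gcomp_iff
    using yz_bounded_multI[OF var_bounded(1) yz_bounded_power[OF var_bounded(2), of n], of 1 1]
      homog_mult[OF homog_var(1)[of 1] h(1)] n by simp
  have L2: "gpoly (D12 * zv 1 ^ (n - 1)) \<in> gcomp d (n + 1)"
    unfolding gpoly_in_gcomp_iff
    using yz_bounded_multI[OF D12_bounded(1) yz_bounded_power[OF var_bounded(2), of "n - 1"], of 1 1]
      homog_mult[OF D12_bounded(2) h(2)] n by simp
  show ?thesis
  proof
    have "GL_submodule d \<alpha> (U_comp d \<alpha> (n + 1))"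
      unfolding GL_submodule_def
    proof (intro conjI ballI allI impI)
      show "subspace_of (U_alg d \<alpha>) (U_comp d \<alpha> (n + 1))"
        unfolding U_alg_def U_comp_def U_img_def by (rule subspace_image[OF subspace_gcomp])
      fix g :: "nat \<Rightarrow> nat \<Rightarrow> 'k" and \<phi> P assume \<phi>: "GL_acts_by d g \<phi>" and P: "P \<in> U_comp d \<alpha> (n + 1)"
      from P obtain p where p: "p \<in> gcomp d (n + 1)" "P = cs p" by (auto simp: U_comp_def U_img_def)
      have endo: "endomorphism (galg d) \<phi>" using \<phi> by (simp add: GL_acts_by_def automorphism_def)
      have "\<phi> (gx i) \<in> gcomp d 1" if "i \<in> {1..d}" for i
      proof -
        have "(\<Sum>k=1..d. gscale (g k i) (gx k)) \<in> gcomp d 1"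
          by (intro subspace_sum[OF subspace_gcomp] subspaceD(4)[OF subspace_gcomp] gx_in_gcomp)
        with \<phi> that show ?thesis unfolding GL_acts_by_def by metis
      qed
      from endomorphism_gcomp[OF endo this p(1)] have "\<phi> p \<in> gcomp d (n + 1)" .
      moreover have "\<phi> ` P = cs (\<phi> p)"
        using automorphism_image_cs[of \<phi> p] \<phi> p gcomp_subset by (auto simp: GL_acts_by_def)
      ultimately show "\<phi> ` P \<in> U_comp d \<alpha> (n + 1)" by (simp add: U_comp_def U_img_def)
    qed
    moreover have "?L \<subseteq> U_comp d \<alpha> (n + 1)" using L1 L2 by (simp add: U_comp_def)
    ultimately show "GL_gen d \<alpha> ?L \<subseteq> U_comp d \<alpha> (n + 1)" unfolding GL_gen_def by blast
  next
    have "U_comp d \<alpha> (n + 1) \<subseteq> S" if sub: "GL_submodule d \<alpha> S" and L: "?L \<subseteq> S" for S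
    proof -
      have SQ: "subspace_of Q S" using sub by (simp add: GL_submodule_def U_alg_def)
      interpret transv_closed d "pre S"
      proof
        show "2 \<le> d" by (rule assms)
        show "subspace_of (galg d) (pre S)" by (rule subspace_pre[OF SQ])
        fix i j :: nat and t :: 'k and f assume ij: "i \<in> {1..d}" "j \<in> {1..d}" "i \<noteq> j" and f: "gpoly f \<in> pre S"
        from transv_GL[OF ij] obtain g where g: "g \<in> GL d" "GL_acts_by d g (ghom (transv i j t))" by blast
        have auto: "automorphism (galg d) (ghom (transv i j t))" by (rule automorphism_transv[OF ij])
        from f have fG: "gpoly f \<in> G d" and "cs (gpoly f) \<in> S" by (simp_all add: pre_def)
        with sub g have "ghom (transv i j t) ` cs (gpoly f) \<in> S" by (simp add: GL_submodule_def)
        then have "cs (gpoly (ev (transv i j t) f)) \<in> S"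
          using automorphism_image_cs[OF auto fG] by simp
        moreover have "gpoly (ev (transv i j t) f) \<in> G d"
          using endomorphism_galgD(1)[OF _ fG, of "ghom (transv i j t)"] auto by (simp add: automorphism_def)
        ultimately show "gpoly (ev (transv i j t) f) \<in> pre S" by (simp add: pre_def)
      qed
      have 1: "gpoly (yv 1 * zv 1 ^ n) \<in> pre S" and 2: "gpoly (D12 * zv 1 ^ (n - 1)) \<in> pre S"
        using L L1 L2 gcomp_subset by (auto simp: pre_def U_img_def)
      \<comment> \<open>The coefficient of t in the image of y_1 z_1^n is y_2 z_1^n + n y_1 z_2
        z_1^(n-1). Subtracting n times the second generator cancels the last term and leaves (n+1)
        y_2 z_1^n.\<close>
      let ?P = "[:yv 1, yv 2 :: 'k yzpoly:] * [:zv 1, zv 2:] ^ n"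
      have ev: "ev (transv 1 2 t) (yv 1 * zv 1 ^ n) = poly ?P (const t)" for t :: 'k
        unfolding ev_mult ev_power poly_mult poly_power by (simp add: transv_def)
      have "gpoly (coeff ?P 1) \<in> pre S"
        by (rule coeff_one_in_S[OF _ _ _ 1 ev]) (use assms in auto)
      moreover have "coeff ?P 1 = yv 2 * zv 1 ^ n + of_nat n * (yv 1 * zv 2 * zv 1 ^ (n - 1))"
        unfolding coeff_mult_low coeff_power_low by (simp add: mult_ac)
      ultimately have "gpoly (yv 2 * zv 1 ^ n + of_nat n * (yv 1 * zv 2 * zv 1 ^ (n - 1))) \<in> pre S"
        by (simp only:)
      then have "gpoly (yv 2 * zv 1 ^ n + of_nat n * (yv 1 * zv 2 * zv 1 ^ (n - 1))
          - const (of_nat n) * (D12 * zv 1 ^ (n - 1))) \<in> pre S"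
        using 2 subspace_gpolyD(2,3)[OF subspace_pre[OF SQ]] by blast
      also have "yv 2 * zv 1 ^ n + of_nat n * (yv 1 * zv 2 * zv 1 ^ (n - 1))
          - const (of_nat n) * (D12 * zv 1 ^ (n - 1)) = of_nat (Suc n) * (yv 2 * zv 1 ^ n)"
        unfolding single_of_nat using n by (cases n) (simp_all add: algebra_simps)
      finally have "gpoly (yv 2 * zv 1 ^ n) \<in> pre S"
        using gpoly_of_nat_multD[OF subspace_pre[OF SQ]] by blast
      then have "gcomp d (Suc n) \<subseteq> pre S"
        using n W_gcomp_in_J[of "Suc n"] J_subset_pre[OF SQ] by (intro gcomp_subset_S) auto
      then show ?thesis by (auto simp: U_comp_def U_img_def pre_def)
    qed
    then show "U_comp d \<alpha> (n + 1) \<subseteq> GL_gen d \<alpha> ?L" unfolding GL_gen_def by blast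
  qed
qed

theorem theorem3p8:
  fixes d :: nat and \<alpha> :: "'k::field_char_0 \<times> 'k"
  assumes "d \<ge> 2" and "snd \<alpha> = 0" and "fst \<alpha> \<noteq> 0"
  shows
    "(\<forall>n\<in>{1, 2}. \<forall>F. U_identity d \<alpha> n F \<longrightarrow>
        U_consequences d \<alpha> (n + 1) F = U_comp d \<alpha> (n + 1)) \<and>
     (\<forall>F. (F = U_img d \<alpha> (w_one 3 1) \<or>
           (\<exists>\<beta>1 \<beta>2. \<beta>2 \<noteq> 0 \<and>
              F = U_img d \<alpha> (gscale \<beta>1 (w_two 2 1 1) + gscale \<beta>2 (w_two 2 1 0)))) \<longrightarrow>
        U_identity d \<alpha> 3 F \<and>
        U_consequences d \<alpha> 4 F = GL_gen d \<alpha> {U_img d \<alpha> (w_one 4 1), U_img d \<alpha> (w_two 3 1 0)} \<and>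
        GL_gen d \<alpha> {U_img d \<alpha> (w_one 4 1), U_img d \<alpha> (w_two 3 1 0)} = U_comp d \<alpha> 4) \<and>
     (\<forall>n\<ge>4. \<forall>F\<in>{U_img d \<alpha> (w_one n 1), U_img d \<alpha> (w_two (n - 1) 1 0)}.
        U_identity d \<alpha> n F \<and>
        U_consequences d \<alpha> (n + 1) F =
          GL_gen d \<alpha> {U_img d \<alpha> (w_one (n + 1) 1), U_img d \<alpha> (w_two n 1 0)} \<and>
        GL_gen d \<alpha> {U_img d \<alpha> (w_one (n + 1) 1), U_img d \<alpha> (w_two n 1 0)} = U_comp d \<alpha> (n + 1)) \<and>
     U_consequences d \<alpha> 4 (U_img d \<alpha> (w_two 2 1 1)) = {zero (U_alg d \<alpha>)}"
proof -
  interpret cubic d "U_ideal d \<alpha>" by (rule U_ideal_cubic[OF assms])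
  have img: "U_img d \<alpha> = cs" by (simp add: U_img_def fun_eq_iff)
  have zero: "zero (U_alg d \<alpha>) = U_ideal d \<alpha>" by (simp add: U_alg_def Q_zero)
  have comp: "U_comp d \<alpha> m = cs ` gcomp d m" for m by (simp add: U_comp_def img)
  have cons: "U_consequences d \<alpha> m (cs f) = consequences m f" for m f
    by (simp add: U_consequences_def comp U_alg_def)
  have w1: "w_one n 1 = gpoly (yv 1 * zv 1 ^ (n - 1) :: 'k yzpoly)" for n
    by (simp add: w_one_def)
  \<comment> \<open>Indexed by the total degree n, to match \<open>D12_implies\<close>.\<close>
  have w2: "w_two (n - 1) 1 0 = gpoly (D12 * zv 1 ^ (n - 2))" for n
    by (simp add: w_two_def numeral_2_eq_2)
  have w21: "w_two 2 1 1 = gpoly (yv 1 * D12)" by (simp add: w_two_def)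
  have GL: "GL_gen d \<alpha> {cs (w_one (n + 1) 1), cs (w_two n 1 0)} = U_comp d \<alpha> (n + 1)" if "3 \<le> n" for n
    using GL_gen_eq_U_comp[OF assms that] w1[of "n + 1"] w2[of "n + 1"] by (simp add: img)
  \<comment> \<open>All cases of (ii) and (iii) reduce to forcing y_2 z_1^n into each T-ideal that
    contains \<open>f\<close> and the defining T-ideal.\<close>
  have good: "U_identity d \<alpha> n (cs f) \<and>
      U_consequences d \<alpha> (n + 1) (cs f) = GL_gen d \<alpha> {cs (w_one (n + 1) 1), cs (w_two n 1 0)} \<and>
      GL_gen d \<alpha> {cs (w_one (n + 1) 1), cs (w_two n 1 0)} = U_comp d \<alpha> (n + 1)"
    if "3 \<le> n" "f \<in> gcomp d n"
      "\<And>T. T_ideal (galg d) T \<Longrightarrow> U_ideal d \<alpha> \<subseteq> T \<Longrightarrow> f \<in> T \<Longrightarrow> gpoly (yv 2 * zv 1 ^ n) \<in> T" for n f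
    using identity_consequences[OF that(2,1,3)] GL[OF that(1)] that(2)
    by (simp add: U_identity_def comp cons zero cs_eq_J_iff)
  have hz: "homog m (zv 1 ^ m :: 'k yzpoly)" for m
    using homog_power[OF homog_var(2), of m 1] by simp
  have bz: "yz_bounded d 0 m (zv 1 ^ m :: 'k yzpoly)" for m
    using yz_bounded_power[OF var_bounded(2), of m] by simp
  have c1: "(w_one n 1 :: 'k gelem) \<in> gcomp d n" if "3 \<le> n" for n
    unfolding w1 gpoly_in_gcomp_iff
    using that homog_mult[OF homog_var(1) hz[of "n - 1"], of 1]
      yz_bounded_multI[OF var_bounded(1) bz[of "n - 1"], of 1 1] by simp
  have c2: "(w_two (n - 1) 1 0 :: 'k gelem) \<in> gcomp d n" if "3 \<le> n" for n
  proof -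
    have "2 + (n - 2) = n" using that by simp
    then show ?thesis
      unfolding w2 gpoly_in_gcomp_iff
      using homog_mult[OF D12_bounded(2) hz[of "n - 2"]]
        yz_bounded_multI[OF D12_bounded(1) bz[of "n - 2"], of 1 1] by simp
  qed
  have c3: "(w_two 2 1 1 :: 'k gelem) \<in> gcomp d 3"
    unfolding w21 gpoly_in_gcomp_iff
    using homog_mult[OF homog_var(1)[of 1] D12_bounded(2)] yz_bounded_multI[OF var_bounded(1) D12_bounded(1), of 1 1]
    by (simp add: numeral_3_eq_3)
  have i1: "gpoly (yv 2 * zv 1 ^ n) \<in> T"
    if "T_ideal (galg d) T" "U_ideal d \<alpha> \<subseteq> T" "3 \<le> n" "w_one n 1 \<in> T" for T :: "'k gelem set" and n
    using y1z1_implies[OF that(1-3)] that(4) unfolding w1 by blast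
  have i2: "gpoly (yv 2 * zv 1 ^ n) \<in> T"
    if "T_ideal (galg d) T" "U_ideal d \<alpha> \<subseteq> T" "3 \<le> n" "w_two (n - 1) 1 0 \<in> T" for T :: "'k gelem set" and n
    \<comment> \<open>Here \<beta>2 = 1 and \<beta>1 = 0, which removes the cubic term.\<close>
    using D12_implies[OF that(1-3), of 1 0] that(4) unfolding w2 by simp
  have i3: "gpoly (yv 2 * zv 1 ^ 3) \<in> T"
    if "T_ideal (galg d) T" "U_ideal d \<alpha> \<subseteq> T" "gscale \<beta>1 (w_two 2 1 1) + gscale \<beta>2 (w_two 2 1 0) \<in> T" "\<beta>2 \<noteq> 0"
    for T :: "'k gelem set" and \<beta>1 \<beta>2
    using D12_implies[OF that(1,2), of 3 \<beta>2 \<beta>1] that(3,4) w2[of 3] unfolding w21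
    by (simp add: gscale_gpoly gpoly_add)
  have p1: "U_consequences d \<alpha> (n + 1) F = U_comp d \<alpha> (n + 1)"
    if n: "n \<in> {1, 2}" and F: "U_identity d \<alpha> n F" for n F
  proof -
    from F obtain f where f: "f \<in> gcomp d n" "F = cs f" by (auto simp: U_identity_def comp)
    with F have "f \<notin> U_ideal d \<alpha>" by (simp add: U_identity_def zero cs_eq_J_iff)
    then have "f \<noteq> 0" using J_simps(1) by blast
    with n f have "consequences (n + 1) f = cs ` gcomp d (n + 1)"
      using degree_one_implies[of _ f] degree_two_implies[of _ f] gcomp_subset[of d]
      by (intro consequences_eq_all) (auto simp: numeral_3_eq_3 numeral_2_eq_2, blast+)
    then show ?thesis by (simp add: f(2) cons comp)
  qed
  have p2: "U_identity d \<alpha> 3 F \<and>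
        U_consequences d \<alpha> 4 F = GL_gen d \<alpha> {cs (w_one 4 1), cs (w_two 3 1 0)} \<and>
        GL_gen d \<alpha> {cs (w_one 4 1), cs (w_two 3 1 0)} = U_comp d \<alpha> 4"
    if "F = cs (w_one 3 1) \<or> (\<exists>\<beta>1 \<beta>2. \<beta>2 \<noteq> 0 \<and> F = cs (gscale \<beta>1 (w_two 2 1 1) + gscale \<beta>2 (w_two 2 1 0)))" for F
    using that
  proof (elim disjE exE conjE)
    assume "F = cs (w_one 3 1)"
    with good[of 3, OF _ c1 i1] show ?thesis by simp
  next
    fix \<beta>1 \<beta>2 :: 'k assume "\<beta>2 \<noteq> 0" and F: "F = cs (gscale \<beta>1 (w_two 2 1 1) + gscale \<beta>2 (w_two 2 1 0))"
    moreover have "gscale \<beta>1 (w_two 2 1 1) + gscale \<beta>2 (w_two 2 1 0) \<in> gcomp d 3"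
      using c2[of 3] by (intro subspaceD(3,4)[OF subspace_gcomp] c3) simp
    ultimately show ?thesis
      using good[of 3 "gscale \<beta>1 (w_two 2 1 1) + gscale \<beta>2 (w_two 2 1 0)"] i3 by simp
  qed
  have p3: "U_identity d \<alpha> n F \<and>
        U_consequences d \<alpha> (n + 1) F = GL_gen d \<alpha> {cs (w_one (n + 1) 1), cs (w_two n 1 0)} \<and>
        GL_gen d \<alpha> {cs (w_one (n + 1) 1), cs (w_two n 1 0)} = U_comp d \<alpha> (n + 1)"
    if "4 \<le> n" "F \<in> {cs (w_one n 1), cs (w_two (n - 1) 1 0)}" for n F
  proof -
    have n: "3 \<le> n" using that by simp
    from that(2) good[OF n c1[OF n] i1[OF _ _ n]] good[OF n c2[OF n] i2[OF _ _ n]] show ?thesis by blast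
  qed
  have p4: "U_consequences d \<alpha> 4 (cs (w_two 2 1 1)) = {U_ideal d \<alpha>}"
    unfolding cons w21 by (rule consequences_D12_y1)
  show ?thesis
    unfolding img zero
    by (intro conjI[OF _ conjI[OF _ conjI]] ballI allI impI p4) (erule (1) p1, erule p2, erule (1) p3)
qed

end
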